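(* Let $(\mathcal X,d,\mu)$ be a space of homogeneous type, $1\le p<q\le\infty$, and let $\{T_t\}_{t>0}$ be a family of sublinear operators. (a) Assume that for some $n>0$, $\mu(B(x,r))\lesssim r^n$ uniformly for all $x\in\mathcal X$ and $r>0$. If $\{T_t\}_{t>0}$ satisfies $L^p(\mu)-L^q(\mu)$ full off-diagonal estimates with exponent $\theta=\frac12\big(\frac np-\frac nq\big)$, then $\{T_t\}_{t>0}$ satisfies $L^p(\mu)-L^q(\mu)$ off-diagonal estimates on balls. (b) Assume that for some $n>0$, $\mu(B(x,r))\gtrsim r^n$ uniformly for all $x\in\mathcal X$ and $r>0$. If $\{T_t\}_{t>0}$ satisfies $L^p(\mu)-L^q(\mu)$ off-diagonal estimates on balls, then $\{T_t\}_{t>0}$ satisfies $L^p(\mu)-L^q(\mu)$ full off-diagonal estimates with exponent $\theta=\frac12\big(\frac np-\frac nq\big)$.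
   Context: A space of homogeneous type $(\mathcal X,d,\mu)$ is a nonempty set $\mathcal X$ with a distance $d$ and a nonnegative Borel measure $\mu$ such that for some $C_0$, $\mu(B(x,2r))\le C_0\,\mu(B(x,r))<\infty$ for all $x\in\mathcal X$, $r>0$, where $B(x,r)=\{y:d(x,y)<r\}$. For a ball $B=B(x_B,r_B)$ write $\lambda B=B(x_B,\lambda r_B)$ and $C_j(B)=2^{j+1}B\setminus 2^jB$ for $j\ge2$. Put $\Upsilon(s)=\max\{s,s^{-1}\}$ for $s>0$; $\chi_E$ is the indicator function of $E$; $d(E,F)=\inf\{d(x,y):x\in E,y\in F\}$. Full off-diagonal estimates: $\{T_t\}_{t>0}$ satisfies $L^p(\mu)-L^q(\mu)$ full off-diagonal estimates with exponent $\theta\ge 0$ ($\theta\neq0$ when $p<q$) if there are $C,c>0$ such that for all closed sets $E,F$, all $f$ and all $t>0$, $$\Big(\int_F|T_t(\chi_Ef)|^qd\mu\Big)^{1/q}\le C\,t^{-\theta}e^{-\frac{c\,d^2(E,F)}{t}}\Big(\int_E|f|^pd\mu\Big)^{1/p}.$$ Off-diagonal estimates on balls: $\{T_t\}_{t>0}$ satisfies $L^p(\mu)-L^q(\mu)$ off-diagonal estimates on balls if there exist $\theta_1,\theta_2>0$, $c>0$ and $C>0$ such that for every $t>0$, every ball $B$ with radius $r=r_B$, and all $f$, $$\Big(\tfrac1{\mu(B)}\int_B|T_t(\chi_Bf)|^q d\mu\Big)^{1/q}\le C\,\Upsilon\big(\tfrac r{\sqrt t}\big)^{\theta_2}\Big(\tfrac1{\mu(B)}\int_B|f|^pd\mu\Big)^{1/p},$$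 and for all $j\ge2$ $$\Big(\tfrac1{\mu(B)}\int_B|T_t(\chi_{C_j(B)}f)|^q d\mu\Big)^{1/q}\le C\,2^{j\theta_1}\Upsilon\big(\tfrac{2^jr}{\sqrt t}\big)^{\theta_2}e^{-\frac{c4^jr^2}{t}}\Big(\tfrac1{\mu(2^{j+1}B)}\int_{C_j(B)}|f|^pd\mu\Big)^{1/p},$$ $$\Big(\tfrac1{\mu(2^{j+1}B)}\int_{C_j(B)}|T_t(\chi_{B}f)|^q d\mu\Big)^{1/q}\le C\,2^{j\theta_1}\Upsilon\big(\tfrac{2^jr}{\sqrt t}\big)^{\theta_2}e^{-\frac{c4^jr^2}{t}}\Big(\tfrac1{\mu(B)}\int_{B}|f|^pd\mu\Big)^{1/p}.$$ Essential suprema are used when $q=\infty$. The operators are defined on some space of functions stable under truncation by indicators of measurable sets and estimates are for $f$ in that space. Sublinear has its usual meaning: $|T(f+g)|\le|Tf|+|Tg|$ and $|T(cf)|=|c||Tf|$.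
   Formalization: Part (b) also assumes: for each t and each f in the domain with finite L^p norm, |T_t f| ≤ liminf |T_t(χ_{B(x,R_k)} f)| a.e. for some x and R_k→∞. Without it (b) fails (a functional vanishing on bounded supports); full estimates imply it. *)

theory Defs
  imports "HOL-Probability.Essential_Supremum"
begin

text \<open>
  The underlying set is a metric space type and the Borel measure is a measure \<open>M\<close> with
  \<open>sets M = sets borel\<close>.
\<close>

definition homogeneous_type :: "'a::metric_space measure \<Rightarrow> bool" where
  "homogeneous_type M \<longleftrightarrow>
     sets M = sets borel \<and>
     (\<exists>C0::real. \<forall>x r. 0 < r \<longrightarrow>
        emeasure M (ball x (2 * r)) \<le> ennreal C0 * emeasure M (ball x r) \<and>
        emeasure M (ball x r) < \<infinity>)"

definition upper_growth :: "'a::metric_space measure \<Rightarrow> real \<Rightarrow> bool" where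
  "upper_growth M n \<longleftrightarrow>
     (\<exists>C>0. \<forall>x r. 0 < r \<longrightarrow> emeasure M (ball x r) \<le> ennreal (C * r powr n))"

definition lower_growth :: "'a::metric_space measure \<Rightarrow> real \<Rightarrow> bool" where
  "lower_growth M n \<longleftrightarrow>
     (\<exists>c>0. \<forall>x r. 0 < r \<longrightarrow> ennreal (c * r powr n) \<le> emeasure M (ball x r))"

definition ennreal_powr :: "ennreal \<Rightarrow> real \<Rightarrow> ennreal" where
  "ennreal_powr u a = (if u = \<infinity> then \<infinity> else ennreal (enn2real u powr a))"
  \<comment> \<open>only used for \<open>a > 0\<close>\<close>

definition lp_norm :: "'a measure \<Rightarrow> ennreal \<Rightarrow> 'a set \<Rightarrow> ('a \<Rightarrow> 'k::real_normed_vector) \<Rightarrow> ennreal" where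
  "lp_norm M p A f =
     (if p = \<infinity> then esssup M (\<lambda>x. ennreal (norm (f x)) * indicator A x)
      else ennreal_powr (\<integral>\<^sup>+x\<in>A. ennreal (norm (f x) powr enn2real p) \<partial>M) (1 / enn2real p))"

text \<open>
  The same integral over \<open>A\<close>, normalised by the measure of a possibly different set \<open>V\<close>. If
  \<open>V\<close> is a null set containing \<open>A\<close>, the quotient below is \<open>0 / 0 = 0\<close> in \<^typ>\<open>ennreal\<close>.
\<close>

definition lp_mean :: "'a measure \<Rightarrow> ennreal \<Rightarrow> 'a set \<Rightarrow> 'a set \<Rightarrow> ('a \<Rightarrow> 'k::real_normed_vector) \<Rightarrow> ennreal" where
  "lp_mean M p V A f =
     (if p = \<infinity> then esssup M (\<lambda>x. ennreal (norm (f x)) * indicator A x)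
      else ennreal_powr
             ((\<integral>\<^sup>+x\<in>A. ennreal (norm (f x) powr enn2real p) \<partial>M) / emeasure M V) (1 / enn2real p))"

definition restr :: "'a set \<Rightarrow> ('a \<Rightarrow> 'k::real_normed_field) \<Rightarrow> 'a \<Rightarrow> 'k" where
  "restr A f = (\<lambda>x. indicator A x * f x)"

text \<open>
  The scalars \<open>'k\<close> may be the reals or the complex numbers. The norms in \<open>lp_norm\<close> are not
  required to be finite on the domain \<open>D\<close>.
\<close>

definition operator_domain ::
    "'a::metric_space measure \<Rightarrow> ('a \<Rightarrow> 'k::{real_normed_field, second_countable_topology}) set \<Rightarrow> bool" where
  "operator_domain M D \<longleftrightarrow>
     D \<subseteq> borel_measurable M \<and>
     (\<lambda>x. 0) \<in> D \<and>
     (\<forall>f\<in>D. \<forall>g\<in>D. (\<lambda>x. f x + g x) \<in> D) \<and>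
     (\<forall>f\<in>D. \<forall>c. (\<lambda>x. c * f x) \<in> D) \<and>
     (\<forall>f\<in>D. \<forall>A\<in>sets M. restr A f \<in> D)"

definition sublinear_operator ::
    "'a::metric_space measure \<Rightarrow> ('a \<Rightarrow> 'k::{real_normed_field, second_countable_topology}) set
      \<Rightarrow> (('a \<Rightarrow> 'k) \<Rightarrow> 'a \<Rightarrow> 'k) \<Rightarrow> bool" where
  "sublinear_operator M D S \<longleftrightarrow>
     (\<forall>f\<in>D. S f \<in> borel_measurable M) \<and>
     (\<forall>f\<in>D. \<forall>g\<in>D. AE x in M. norm (S (\<lambda>y. f y + g y) x) \<le> norm (S f x) + norm (S g x)) \<and>
     (\<forall>f\<in>D. \<forall>c. AE x in M. norm (S (\<lambda>y. c * f y) x) = norm c * norm (S f x))"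

text \<open>
  \<^const>\<open>setdist\<close> is \<open>0\<close> if one of the sets is empty. This is immaterial here: for
  sublinear operators the left-hand side of the estimate then vanishes.
\<close>

definition full_off_diagonal ::
    "'a::metric_space measure \<Rightarrow> ('a \<Rightarrow> 'k::{real_normed_field, second_countable_topology}) set
      \<Rightarrow> (real \<Rightarrow> ('a \<Rightarrow> 'k) \<Rightarrow> 'a \<Rightarrow> 'k) \<Rightarrow> ennreal \<Rightarrow> ennreal \<Rightarrow> real \<Rightarrow> bool" where
  "full_off_diagonal M D T p q \<theta> \<longleftrightarrow>
     0 \<le> \<theta> \<and> (p < q \<longrightarrow> \<theta> \<noteq> 0) \<and>
     (\<exists>C>0. \<exists>c>0. \<forall>E F. closed E \<longrightarrow> closed F \<longrightarrow>
        (\<forall>f\<in>D. \<forall>t>0.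
           lp_norm M q F (T t (restr E f))
             \<le> ennreal (C * t powr (- \<theta>) * exp (- (c * (setdist E F)\<^sup>2 / t))) * lp_norm M p E f))"

definition Upsilon :: "real \<Rightarrow> real" where
  "Upsilon s = max s (inverse s)"

definition dyadic_annulus :: "nat \<Rightarrow> 'a::metric_space \<Rightarrow> real \<Rightarrow> 'a set" where
  "dyadic_annulus j x r = ball x (2 ^ (j + 1) * r) - ball x (2 ^ j * r)"

definition off_diagonal_on_balls ::
    "'a::metric_space measure \<Rightarrow> ('a \<Rightarrow> 'k::{real_normed_field, second_countable_topology}) set
      \<Rightarrow> (real \<Rightarrow> ('a \<Rightarrow> 'k) \<Rightarrow> 'a \<Rightarrow> 'k) \<Rightarrow> ennreal \<Rightarrow> ennreal \<Rightarrow> bool" where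
  "off_diagonal_on_balls M D T p q \<longleftrightarrow>
     (\<exists>\<theta>1>0. \<exists>\<theta>2>0. \<exists>c>0. \<exists>C>0. \<forall>t>0. \<forall>x. \<forall>r>0. \<forall>f\<in>D.
        lp_mean M q (ball x r) (ball x r) (T t (restr (ball x r) f))
          \<le> ennreal (C * Upsilon (r / sqrt t) powr \<theta>2) * lp_mean M p (ball x r) (ball x r) f \<and>
        (\<forall>j\<ge>2.
          lp_mean M q (ball x r) (ball x r) (T t (restr (dyadic_annulus j x r) f))
            \<le> ennreal (C * 2 powr (real j * \<theta>1) * Upsilon (2 ^ j * r / sqrt t) powr \<theta>2
                        * exp (- (c * 4 ^ j * r\<^sup>2 / t)))
               * lp_mean M p (ball x (2 ^ (j + 1) * r)) (dyadic_annulus j x r) f \<and>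
          lp_mean M q (ball x (2 ^ (j + 1) * r)) (dyadic_annulus j x r) (T t (restr (ball x r) f))
            \<le> ennreal (C * 2 powr (real j * \<theta>1) * Upsilon (2 ^ j * r / sqrt t) powr \<theta>2
                        * exp (- (c * 4 ^ j * r\<^sup>2 / t)))
               * lp_mean M p (ball x r) (ball x r) f))"

text \<open>
  Estimates on balls only involve functions of bounded support, and finite sublinearity alone
  does not relate \<open>S f\<close> to the truncations of \<open>f\<close> to balls: on the real line, \<open>S f = L f \<cdot> g\<close>
  with \<open>L\<close> a nonzero linear functional on \<open>L\<^sup>p\<close> vanishing on all functions of bounded support
  satisfies every estimate on balls but no global bound. The condition below is the minimal
  compatibility with truncation that excludes this. It holds trivially if \<open>f\<close> has bounded support,
  and also if \<open>S\<close> is continuous from \<open>L\<^sup>p\<close> (\<open>p < \<infinity>\<close>) to local convergence in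
  measure. Conversely, full off-diagonal estimates with \<open>p < \<infinity>\<close> imply it (take
  \<open>E = F = UNIV\<close> and pass to a subsequence of \<open>S (f - restr (ball x k) f)\<close>).
\<close>

definition determined_by_truncations ::
    "'a::metric_space measure \<Rightarrow> ennreal \<Rightarrow> ('a \<Rightarrow> 'k::{real_normed_field, second_countable_topology}) set
      \<Rightarrow> (('a \<Rightarrow> 'k) \<Rightarrow> 'a \<Rightarrow> 'k) \<Rightarrow> bool" where
  "determined_by_truncations M p D S \<longleftrightarrow>
     (\<forall>f\<in>D. lp_norm M p UNIV f < \<infinity> \<longrightarrow>
        (\<exists>x. \<exists>R::nat \<Rightarrow> real. filterlim R at_top sequentially \<and>
           (AE y in M. ennreal (norm (S f y))
              \<le> liminf (\<lambda>k. ennreal (norm (S (restr (ball x (R k)) f) y))))))"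

end

theory Submission
  imports Defs
begin

text \<open>
  (a) The balls and annuli sit inside closed sets at distance comparable to \<open>2 ^ j r\<close>, so the
  estimates on balls are the full ones, renormalised by powers of volumes. Doubling compares the two
  volumes involved, and the growth \<open>\<mu>(B) \<lesssim> r powr n\<close> turns the volume power
  \<open>1 / p - 1 / q\<close> into \<open>r powr (2 * \<theta>)\<close>, which combines with \<open>t powr - \<theta>\<close>.

  (b) Cover \<open>F\<close> by balls \<open>B\<close> of radius \<open>\<surd>t\<close> centred at a maximal separated set, and on each of
  them split \<open>f\<close> along \<open>4B\<close> and the annuli \<open>C\<^sub>j(B)\<close>. At this scale \<open>\<Upsilon>\<close> is harmless and the lower
  growth bound produces \<open>t powr - \<theta>\<close>. A piece contributes only if \<open>d(E, F) \<lesssim> 2 ^ j \<surd>t\<close>, so half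
  of the decay \<open>exp (- c 4 ^ j)\<close> yields the off-diagonal factor. The other half beats
  the overlap of the enlarged balls, which is exponential in \<open>j\<close> by doubling. Truncation and Fatou's
  lemma reduce to \<open>f\<close> of bounded support, for which the splitting is finite.
\<close>

section \<open>Powers and norms\<close>

lemma ennreal_powr_ennreal [simp]: "0 \<le> x \<Longrightarrow> ennreal_powr (ennreal x) a = ennreal (x powr a)"
  by (simp add: ennreal_powr_def)

lemma ennreal_powr_top [simp]: "ennreal_powr top a = top"
  by (simp add: ennreal_powr_def)

lemma ennreal_powr_0 [simp]: "ennreal_powr 0 a = 0"
  by (simp add: ennreal_powr_def)

lemma ennreal_powr_one [simp]: "ennreal_powr u 1 = u"
  by (cases u) auto

lemma ennreal_powr_mono:
  assumes "u \<le> v" "0 \<le> a"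
  shows "ennreal_powr u a \<le> ennreal_powr v a"
  using assms by (cases u; cases v) (auto simp: top_unique intro!: ennreal_leI powr_mono2)

lemma ennreal_powr_powr: "ennreal_powr (ennreal_powr u a) b = ennreal_powr u (a * b)"
  by (cases u) (auto simp: powr_powr)

lemma ennreal_powr_mult: "ennreal_powr (u * v) a = ennreal_powr u a * ennreal_powr v a"
proof (cases "u = 0 \<or> v = 0")
  case False
  then show ?thesis
    by (cases u; cases v)
       (auto simp: powr_mult ennreal_mult[symmetric] ennreal_top_mult ennreal_mult_top)
qed auto

lemma ennreal_powr_add: "ennreal_powr u (a + b) = ennreal_powr u a * ennreal_powr u b"
  by (cases u) (auto simp: powr_add ennreal_mult)

lemma ennreal_powr_le_iff:
  assumes "0 < a"
  shows "ennreal_powr u (1 / a) \<le> v \<longleftrightarrow> u \<le> ennreal_powr v a"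
proof
  assume "ennreal_powr u (1 / a) \<le> v"
  from ennreal_powr_mono[OF this, of a] assms show "u \<le> ennreal_powr v a"
    by (simp add: ennreal_powr_powr)
next
  assume "u \<le> ennreal_powr v a"
  from ennreal_powr_mono[OF this, of "1 / a"] assms show "ennreal_powr u (1 / a) \<le> v"
    by (simp add: ennreal_powr_powr)
qed

text \<open>No case distinction is needed: at \<open>p = \<infinity>\<close> the right side is
  \<open>1 / 0 = 0\<close>, and at \<open>p = 0\<close> the left side is the real part of
  \<open>\<infinity>\<close>, also \<open>0\<close>. Thus \<open>enn2real (1 / p)\<close> is the
  usual reciprocal exponent, equal to \<open>0\<close> at infinity.\<close>

lemma enn2real_inverse: "enn2real (1 / p) = 1 / enn2real p"
  by (cases p; cases "p = 0")
     (auto simp: divide_ennreal_def inverse_ennreal field_simps)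

section \<open>Local norms and normalised means\<close>

lemma lp_norm_finite:
  "p \<noteq> \<infinity> \<Longrightarrow> lp_norm M p A f =
     ennreal_powr (\<integral>\<^sup>+x\<in>A. ennreal (norm (f x) powr enn2real p) \<partial>M) (1 / enn2real p)"
  by (simp add: lp_norm_def)

text \<open>Moves a norm bound to the level of integrals, where sums over a cover and Fatou's lemma
  apply directly.\<close>

lemma lp_norm_le_iff:
  assumes "p \<noteq> \<infinity>" "0 < p"
  shows "lp_norm M p A f \<le> K \<longleftrightarrow>
    (\<integral>\<^sup>+x\<in>A. ennreal (norm (f x) powr enn2real p) \<partial>M) \<le> ennreal_powr K (enn2real p)"
proof -
  have "0 < enn2real p"
    using assms by (simp add: enn2real_positive_iff less_top)
  with assms show ?thesis
    by (simp add: lp_norm_finite ennreal_powr_le_iff)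
qed

lemma esssup_eq_0:
  fixes g :: "'a \<Rightarrow> ennreal"
  assumes "g \<in> borel_measurable M" "AE x in M. g x = 0"
  shows "esssup M g = 0"
proof -
  have "esssup M g \<le> 0"
    using assms by (intro esssup_I) (auto elim: eventually_mono)
  then show ?thesis by simp
qed

lemma lp_norm_eq_0:
  assumes [measurable]: "f \<in> borel_measurable M" "A \<in> sets M"
    and "AE x in M. x \<in> A \<longrightarrow> f x = 0" "0 < p"
  shows "lp_norm M p A f = 0"
proof (cases "p = \<infinity>")
  case True
  with assms(3) show ?thesis
    by (auto simp: lp_norm_def intro!: esssup_eq_0 elim!: eventually_mono split: split_indicator)
next
  case False
  have "(\<integral>\<^sup>+x\<in>A. ennreal (norm (f x) powr enn2real p) \<partial>M) = (\<integral>\<^sup>+x. 0 \<partial>M)"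
    using assms(3) by (intro nn_integral_cong_AE) (auto elim!: eventually_mono split: split_indicator)
  with False show ?thesis
    by (simp add: lp_norm_finite)
qed

lemma lp_norm_mono:
  assumes [measurable]: "f \<in> borel_measurable M" "A \<in> sets M" 
    and "AE x in M. x \<in> A \<longrightarrow> x \<in> B \<and> norm (f x) \<le> norm (g x)"
  shows "lp_norm M p A f \<le> lp_norm M p B g"
proof (cases "p = \<infinity>")
  case True
  with assms(3) show ?thesis
    by (auto simp: lp_norm_def intro!: esssup_AE_mono elim!: eventually_mono split: split_indicator)
next
  case False
  with assms(3) show ?thesis
    by (auto simp: lp_norm_finite intro!: ennreal_powr_mono nn_integral_mono_AE ennreal_leI
      powr_mono2 elim!: eventually_mono split: split_indicator)
qed

text \<open>The two kinds of estimate differ by a power of the volume. At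
  \<open>p = \<infinity>\<close> the exponent is \<open>0\<close> and the factor is
  \<open>1\<close>, so one formula serves finite and infinite exponents alike.\<close>

lemma lp_mean_eq:
  assumes "0 < emeasure M V" "emeasure M V < \<infinity>"
  shows "lp_mean M p V A f = lp_norm M p A f * ennreal (measure M V powr - enn2real (1 / p))"
proof -
  have m: "emeasure M V = ennreal (measure M V)"
    using assms by (simp add: emeasure_eq_ennreal_measure)
  have pos: "0 < measure M V"
    using assms by (simp add: measure_def enn2real_positive_iff)
  have div: "u / emeasure M V = u * ennreal (1 / measure M V)" for u
    unfolding m using pos by (simp add: divide_ennreal_def inverse_ennreal inverse_eq_divide)
  have pow: "(1 / measure M V) powr a = measure M V powr - a" for a
    using pos by (simp add: powr_divide powr_minus_divide)
  show ?thesis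
    using pos by (simp add: lp_mean_def lp_norm_def div ennreal_powr_mult enn2real_inverse pow)
qed

lemma restr_restr: "restr A (restr B f) = restr (A \<inter> B) f"
  by (auto simp: restr_def indicator_def)

lemma lp_norm_restr:
  assumes "0 < p"
  shows "lp_norm M p B (restr A f) = lp_norm M p (A \<inter> B) f"
proof (cases "p = \<infinity>")
  case True
  have "(\<lambda>x. ennreal (norm (restr A f x)) * indicator B x)
      = (\<lambda>x. ennreal (norm (f x)) * indicator (A \<inter> B) x)"
    by (auto simp: restr_def split: split_indicator)
  with True show ?thesis
    by (simp add: lp_norm_def)
next
  case False
  have "(\<lambda>x. ennreal (norm (restr A f x) powr enn2real p) * indicator B x)
      = (\<lambda>x. ennreal (norm (f x) powr enn2real p) * indicator (A \<inter> B) x)"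
    by (auto simp: restr_def split: split_indicator)
  with False show ?thesis
    by (simp add: lp_norm_def)
qed

lemma lp_mean_null_space:
  fixes g :: "'a \<Rightarrow> 'k::{real_normed_vector, second_countable_topology}"
  assumes "AE y in M. False" and [measurable]: "g \<in> borel_measurable M" "A \<in> sets M"
  shows "lp_mean M p V A g = 0"
proof (cases "p = \<infinity>")
  case True
  then show ?thesis
    using assms by (auto simp: lp_mean_def intro!: esssup_eq_0)
next
  case False
  have "(\<integral>\<^sup>+x\<in>A. ennreal (norm (g x) powr enn2real p) \<partial>M) = (\<integral>\<^sup>+x. 0 \<partial>M)"
    using assms(1) by (intro nn_integral_cong_AE) auto
  with False show ?thesis
    by (simp add: lp_mean_def)
qed

section \<open>Doubling measures\<close>

lemma dyadic_annulus_sets [measurable]: "dyadic_annulus j x r \<in> sets borel"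
  by (simp add: dyadic_annulus_def)

text \<open>Taking \<open>C0 \<ge> 2\<close> makes the exponent \<open>\<theta>1 = log 2 C0\<close> of part (a) positive.\<close>

locale doubling_space =
  fixes M :: "'a::metric_space measure" and C0 :: real
  assumes sets_M [measurable_cong, simp]: "sets M = sets borel"
    and C0: "2 \<le> C0"
    and finite_ball: "0 < r \<Longrightarrow> emeasure M (ball x r) < \<infinity>"
    and doubling: "0 < r \<Longrightarrow> measure M (ball x (2 * r)) \<le> C0 * measure M (ball x r)"
begin

lemma space_M [simp]: "space M = UNIV"
  using sets_eq_imp_space_eq[OF sets_M] by simp

lemma emeasure_ball: "emeasure M (ball x r) = ennreal (measure M (ball x r))"
  using finite_ball[of r x] by (cases "0 < r") (auto simp: emeasure_eq_ennreal_measure ball_empty)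

lemma measure_mono_ball:
  assumes "A \<subseteq> ball x r" "A \<in> sets M"
  shows "measure M A \<le> measure M (ball x r)"
proof -
  have "emeasure M (ball x r) \<noteq> \<infinity>"
    by (simp add: emeasure_ball)
  with assms show ?thesis
    by (intro measure_mono_fmeasurable) (auto simp: fmeasurable_def less_top)
qed

lemma doubling_pow:
  assumes "0 < r"
  shows "measure M (ball x (2 ^ k * r)) \<le> C0 ^ k * measure M (ball x r)"
proof (induction k)
  case (Suc k)
  have "measure M (ball x (2 ^ Suc k * r)) \<le> C0 * measure M (ball x (2 ^ k * r))"
    using doubling[of "2 ^ k * r" x] assms by (simp add: mult.assoc)
  also have "\<dots> \<le> C0 * (C0 ^ k * measure M (ball x r))"
    using C0 Suc by (intro mult_left_mono) auto
  finally show ?case by (simp add: mult.assoc)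
qed simp

text \<open>Doubling carries nullity from one ball to all its dyadic dilates, and these exhaust the
  space. So either the measure is trivial or every ball has positive volume.\<close>

lemma null_ball_imp_null:
  assumes "measure M (ball x r) = 0" "0 < r"
  shows "AE y in M. False"
proof -
  have "AE y in M. y \<notin> ball x (2 ^ k * r)" for k
  proof (rule AE_not_in)
    have "measure M (ball x (2 ^ k * r)) = 0"
      using doubling_pow[of r x k] assms measure_nonneg[of M "ball x (2 ^ k * r)"] by simp
    then show "ball x (2 ^ k * r) \<in> null_sets M"
      by (auto simp: null_sets_def emeasure_ball)
  qed
  then have "AE y in M. \<forall>k. y \<notin> ball x (2 ^ k * r)"
    by (simp add: AE_all_countable)
  moreover have "\<exists>k. y \<in> ball x (2 ^ k * r)" for y
  proof -
    obtain k where "dist x y / r < 2 ^ k"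
      using real_arch_pow[of 2 "dist x y / r"] by auto
    with assms show ?thesis by (auto simp: field_simps intro!: exI[of _ k])
  qed
  ultimately show ?thesis
    by (rule_tac eventually_mono) blast+
qed

end

lemma homogeneous_type_imp_doubling:
  fixes M :: "'a::metric_space measure"
  assumes "homogeneous_type M"
  obtains C0 where "doubling_space M C0"
proof -
  obtain C where sets: "sets M = sets borel"
    and C: "\<And>x r. 0 < r \<Longrightarrow> emeasure M (ball x (2 * r)) \<le> ennreal C * emeasure M (ball x r)"
    and fin: "\<And>x r. 0 < r \<Longrightarrow> emeasure M (ball x r) < \<infinity>"
    using assms unfolding homogeneous_type_def by blast
  have "doubling_space M (max C 2)"
  proof
    fix x :: 'a and r :: real assume r: "0 < r"
    have *: "emeasure M (ball x s) = ennreal (measure M (ball x s))" if "0 < s" for s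
      using fin[OF that, of x] by (simp add: emeasure_eq_ennreal_measure)
    have "ennreal (measure M (ball x (2 * r))) \<le> ennreal C * ennreal (measure M (ball x r))"
      using C[OF r, of x] r by (simp add: *)
    also have "\<dots> \<le> ennreal (max C 2) * ennreal (measure M (ball x r))"
      by (intro mult_right_mono ennreal_leI) auto
    also have "\<dots> = ennreal (max C 2 * measure M (ball x r))"
      by (intro ennreal_mult[symmetric]) auto
    finally show "measure M (ball x (2 * r)) \<le> max C 2 * measure M (ball x r)"
      by (subst (asm) ennreal_le_iff) auto
  qed (use sets fin in auto)
  then show ?thesis by (rule that)
qed

section \<open>Volume powers in the passage from norms to means\<close>

lemma enn2real_inverse_less:
  assumes "1 \<le> p" "p < q"
  shows "0 \<le> enn2real (1 / q)" "enn2real (1 / q) < enn2real (1 / p)" "enn2real (1 / p) \<le> 1"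
proof -
  obtain P where P: "p = ennreal P" "1 \<le> P"
    using assms by (cases p) (auto simp: ennreal_1[symmetric] simp del: ennreal_1)
  show "0 \<le> enn2real (1 / q)" by simp
  show "enn2real (1 / p) \<le> 1"
    using P by (simp add: enn2real_inverse)
  show "enn2real (1 / q) < enn2real (1 / p)"
    using P assms by (cases q) (auto simp: enn2real_inverse ennreal_less_iff frac_less2)
qed

context doubling_space
begin

text \<open>Balls and annuli need not be closed, so \<open>A\<close> and \<open>B\<close> are
  enlarged to closed sets \<open>E\<close> and \<open>F\<close>; restricting to \<open>E\<close>
  leaves \<open>restr A f\<close> unchanged. Passing to means over \<open>V\<close> and
  \<open>W\<close> then costs only the two volume powers.\<close>

lemma full_off_diagonal_imp_lp_mean_le:
  fixes D :: "('a \<Rightarrow> 'k::{real_normed_field, second_countable_topology}) set"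
  assumes full: "\<And>E F f t. closed E \<Longrightarrow> closed F \<Longrightarrow> f \<in> D \<Longrightarrow> 0 < t \<Longrightarrow>
      lp_norm M q F (T t (restr E f))
        \<le> ennreal (C * t powr - \<theta> * exp (- (c * (setdist E F)\<^sup>2 / t))) * lp_norm M p E f"
    and D: "operator_domain M D"
    and S: "\<And>t. 0 < t \<Longrightarrow> sublinear_operator M D (T t)"
    and f: "f \<in> D" and t: "0 < t" and C: "0 < C" and c: "0 < c" and p: "0 < p" and q: "0 < q"
    and A: "A \<in> sets M" "A \<subseteq> E" "closed E" and B: "B \<in> sets M" "B \<subseteq> F" "closed F"
    and d: "0 \<le> d" "E \<noteq> {} \<Longrightarrow> F \<noteq> {} \<Longrightarrow> d \<le> setdist E F"
    and V: "0 < emeasure M V" "emeasure M V < \<infinity>"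
    and W: "0 < emeasure M W" "emeasure M W < \<infinity>"
  shows "lp_mean M q W B (T t (restr A f))
    \<le> ennreal (C * t powr - \<theta> * exp (- (c * d\<^sup>2 / t)) *
         (measure M V powr enn2real (1 / p) * measure M W powr - enn2real (1 / q)))
      * lp_mean M p V A f"
proof -
  have Af: "restr A f \<in> D" using D f A unfolding operator_domain_def by auto
  have Tm: "T t (restr A f) \<in> borel_measurable M"
    using S[OF t] Af unfolding sublinear_operator_def by auto
  have EA: "restr E (restr A f) = restr A f"
    using A by (simp add: restr_restr Int_absorb1)
  have nA: "lp_norm M p E (restr A f) = lp_norm M p A f"
    using A by (simp add: lp_norm_restr[OF p] Int_absorb2)
  have mV: "0 < measure M V" using V by (simp add: measure_def enn2real_positive_iff)
  have main: "lp_norm M q F (T t (restr A f))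
      \<le> ennreal (C * t powr - \<theta> * exp (- (c * d\<^sup>2 / t))) * lp_norm M p A f"
  \<comment> \<open>If a set is empty, \<open>setdist\<close> is \<open>0\<close> and need not
    dominate \<open>d\<close>. The left side is then \<open>0\<close>, either by the estimate with
    \<open>E\<close> empty or because the norm is taken over the empty set.\<close>
  proof (cases "E = {} \<or> F = {}")
    case True
    have *: "lp_norm M r {} g = 0" if "0 < r" for r and g :: "'a \<Rightarrow> 'k"
    proof -
      have "lp_norm M r {} g = lp_norm M r {} (\<lambda>_. 0 :: 'k)"
        by (simp add: lp_norm_def)
      also have "\<dots> = 0" using that by (intro lp_norm_eq_0) auto
      finally show ?thesis .
    qed
    from True show ?thesis
    proof
      assume "E = {}"
      with full[OF A(3) B(3) Af t] nA EA show ?thesis by (simp add: *[OF p])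
    next
      assume "F = {}"
      then show ?thesis by (simp add: *[OF q])
    qed
  next
    case False
    have "d\<^sup>2 \<le> (setdist E F)\<^sup>2" using d False by (intro power_mono) auto
    then have "C * t powr - \<theta> * exp (- (c * (setdist E F)\<^sup>2 / t))
        \<le> C * t powr - \<theta> * exp (- (c * d\<^sup>2 / t))"
      using C c t by (intro mult_left_mono) (auto intro!: divide_right_mono mult_left_mono)
    with full[OF A(3) B(3) Af t] show ?thesis
      unfolding EA nA by (elim order_trans) (intro mult_right_mono ennreal_leI, auto)
  qed
  let ?K = "C * t powr - \<theta> * exp (- (c * d\<^sup>2 / t))"
  let ?a = "enn2real (1 / p)" and ?b = "enn2real (1 / q)"
  have "lp_mean M q W B (T t (restr A f))
      \<le> lp_norm M q F (T t (restr A f)) * ennreal (measure M W powr - ?b)"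
    unfolding lp_mean_eq[OF W] using B Tm by (intro mult_right_mono lp_norm_mono) auto
  also have "\<dots> \<le> ennreal ?K * lp_norm M p A f * ennreal (measure M W powr - ?b)"
    by (intro mult_right_mono main) auto
  also have "lp_norm M p A f = lp_mean M p V A f * ennreal (measure M V powr ?a)"
    unfolding lp_mean_eq[OF V] using mV
    by (simp add: mult.assoc ennreal_mult[symmetric] powr_add[symmetric])
  also have "ennreal ?K * (lp_mean M p V A f * ennreal (measure M V powr ?a)) * ennreal (measure M W powr - ?b)
      = (ennreal ?K * (ennreal (measure M V powr ?a) * ennreal (measure M W powr - ?b))) * lp_mean M p V A f"
    by (simp only: ac_simps)
  also have "(ennreal ?K * (ennreal (measure M V powr ?a) * ennreal (measure M W powr - ?b)))
     = ennreal (?K * (measure M V powr ?a * measure M W powr - ?b))"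
    using C by (simp add: ennreal_mult[symmetric])
  finally show ?thesis .
qed

text \<open>Both volumes are compared with that of the ball of radius \<open>2 ^ k * r\<close>:
  \<open>V\<close> is at most this volume, and \<open>W\<close> is smaller by at most
  \<open>C0 ^ k\<close> by doubling. What remains is its power \<open>a - b\<close>, to which the
  growth bound applies, and \<open>b \<le> 1\<close> keeps the doubling loss below
  \<open>C0 ^ k\<close>. The powers of \<open>r\<close> and \<open>t\<close> combine into a power of
  \<open>2 ^ k * r / sqrt t\<close>.\<close>

lemma volume_factor:
  assumes Cu: "0 < Cu" "measure M (ball x (2 ^ k * r)) \<le> Cu * (2 ^ k * r) powr n"
    and ab: "0 \<le> b" "b < a" "b \<le> 1" and r: "0 < r" and t: "0 < t"
    and V: "measure M V \<le> measure M (ball x (2 ^ k * r))"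
    and W: "measure M (ball x r) \<le> measure M W" and pos: "0 < measure M (ball x r)"
  shows "t powr - ((n * a - n * b) / 2) * (measure M V powr a * measure M W powr - b)
    \<le> C0 ^ k * Cu powr (a - b) * (2 ^ k * r / sqrt t) powr (n * a - n * b)"
proof -
  define m where "m = measure M (ball x (2 ^ k * r))"
  have mk: "m \<le> C0 ^ k * measure M (ball x r)" unfolding m_def by (rule doubling_pow[OF r])
  have "measure M (ball x (1 * r)) \<le> m"
    unfolding m_def using r C0 by (intro measure_mono_ball subset_ball mult_right_mono) auto
  with pos have m: "0 < m" by simp
  have C0k: "1 \<le> C0 ^ k" using C0 by (intro one_le_power) auto
  have "measure M V powr a \<le> m powr a"
    using V ab unfolding m_def by (intro powr_mono2) auto
  moreover have "measure M W powr - b \<le> (m / C0 ^ k) powr - b"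
    using mk m W ab C0k by (intro powr_mono2') (auto simp: field_simps intro: order_trans)
  ultimately have "measure M V powr a * measure M W powr - b \<le> m powr a * (m / C0 ^ k) powr - b"
    by (intro mult_mono) auto
  also have "\<dots> = m powr (a - b) * (C0 ^ k) powr b"
    using m C0k by (simp add: powr_divide powr_diff powr_minus divide_simps)
  also have "\<dots> \<le> (Cu * (2 ^ k * r) powr n) powr (a - b) * (C0 ^ k) powr 1"
    using m ab Cu C0k unfolding m_def by (intro mult_mono powr_mono2 powr_mono) auto
  also have "\<dots> = Cu powr (a - b) * (2 ^ k * r) powr (n * a - n * b) * C0 ^ k"
    using Cu r C0k by (simp add: powr_mult powr_powr right_diff_distrib)
  finally have *: "measure M V powr a * measure M W powr - b
    \<le> Cu powr (a - b) * (2 ^ k * r) powr (n * a - n * b) * C0 ^ k" .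
  have **: "(2 ^ k * r / sqrt t) powr (n * a - n * b)
      = (2 ^ k * r) powr (n * a - n * b) * t powr - ((n * a - n * b) / 2)"
    using r t by (simp add: powr_divide powr_half_sqrt[symmetric] powr_powr powr_minus divide_simps)
  show ?thesis
    using mult_left_mono[OF *, of "t powr - ((n * a - n * b) / 2)"]
    unfolding ** by (simp add: ac_simps)
qed

end

section \<open>From full estimates to balls\<close>

lemma Upsilon_ge: "s \<le> Upsilon s"
  by (simp add: Upsilon_def)

context doubling_space
begin

lemma full_off_diagonal_imp_on_balls:
  fixes D :: "('a \<Rightarrow> 'k::{real_normed_field, second_countable_topology}) set"
  assumes D: "operator_domain M D" and S: "\<And>t. 0 < t \<Longrightarrow> sublinear_operator M D (T t)"
    and pq: "1 \<le> p" "p < q" and n: "0 < n" and growth: "upper_growth M n"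
    and full: "full_off_diagonal M D T p q ((n * enn2real (1 / p) - n * enn2real (1 / q)) / 2)"
  shows "off_diagonal_on_balls M D T p q"
proof -
  define a b where "a = enn2real (1 / p)" and "b = enn2real (1 / q)"
  have ab: "0 \<le> b" "b < a" "b \<le> 1"
    using enn2real_inverse_less[OF pq] by (auto simp: a_def b_def)
  \<comment> \<open>Twice the given exponent; it becomes \<open>\<theta>2\<close> in the estimates
    on balls.\<close>
  define \<tau> where "\<tau> = n * a - n * b"
  have \<tau>: "0 < \<tau>" using n ab by (simp add: \<tau>_def)
  obtain C c where C: "0 < C" and c: "0 < c"
    and all: "\<forall>E F. closed E \<longrightarrow> closed F \<longrightarrow> (\<forall>f\<in>D. \<forall>t>0.
      lp_norm M q F (T t (restr E f))
        \<le> ennreal (C * t powr - (\<tau> / 2) * exp (- (c * (setdist E F)\<^sup>2 / t))) * lp_norm M p E f)"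
    using full unfolding full_off_diagonal_def a_def[symmetric] b_def[symmetric] \<tau>_def[symmetric]
    by (elim conjE exE) (rule that)
  note fod = all[rule_format]
  obtain Cu where Cu: "0 < Cu"
    and vol: "\<And>x r. 0 < r \<Longrightarrow> measure M (ball x r) \<le> Cu * r powr n"
    using growth unfolding upper_growth_def emeasure_ball by (auto simp: ennreal_le_iff)
  \<comment> \<open>The annuli are measured by balls of radius \<open>2 ^ (j + 1) * r\<close>. The
    factors \<open>C0\<close> and \<open>2 powr \<tau>\<close> absorb the extra step from
    \<open>j\<close> to \<open>j + 1\<close> in the doubling loss and in the ratio of
    scales.\<close>
  define K where "K = C * (C0 * Cu powr (a - b) * 2 powr \<tau>)"
  have K: "0 < K" using C C0 Cu by (simp add: K_def)
  have p: "0 < p" and q: "0 < q"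
    using pq by (auto intro: less_le_trans[OF zero_less_one] less_trans)
  let ?A = "dyadic_annulus"
  have "lp_mean M q (ball x r) (ball x r) (T t (restr (ball x r) f))
        \<le> ennreal (K * Upsilon (r / sqrt t) powr \<tau>) * lp_mean M p (ball x r) (ball x r) f"
      (is ?est1)
    and "2 \<le> j \<Longrightarrow> lp_mean M q (ball x r) (ball x r) (T t (restr (?A j x r) f))
        \<le> ennreal (K * 2 powr (real j * log 2 C0) * Upsilon (2 ^ j * r / sqrt t) powr \<tau>
              * exp (- (c * 9 / 16 * 4 ^ j * r\<^sup>2 / t)))
           * lp_mean M p (ball x (2 ^ (j + 1) * r)) (?A j x r) f" (is "_ \<Longrightarrow> ?est2")
    and "2 \<le> j \<Longrightarrow> lp_mean M q (ball x (2 ^ (j + 1) * r)) (?A j x r) (T t (restr (ball x r) f))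
        \<le> ennreal (K * 2 powr (real j * log 2 C0) * Upsilon (2 ^ j * r / sqrt t) powr \<tau>
              * exp (- (c * 9 / 16 * 4 ^ j * r\<^sup>2 / t)))
           * lp_mean M p (ball x r) (ball x r) f" (is "_ \<Longrightarrow> ?est3")
    if t: "0 < t" and r: "0 < r" and f: "f \<in> D" for t x r f j
  proof -
    have Tm: "T t (restr A f) \<in> borel_measurable M" if "A \<in> sets M" for A
      using S[OF t] D f that unfolding sublinear_operator_def operator_domain_def by auto
    have "?est1 \<and> (2 \<le> j \<longrightarrow> ?est2 \<and> ?est3)"
    proof (cases "measure M (ball x r) = 0")
      case True
      note null = null_ball_imp_null[OF True r]
      show ?thesis
        by (simp add: lp_mean_null_space[OF null] Tm)
    next
      case False
      then have pos: "0 < measure M (ball x r)"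
        by (simp add: less_le)
      define s where "s = 2 ^ (j + 1) * r"
      have s: "r \<le> s" using r one_le_power[of "2::real" "j + 1"]
        by (simp add: s_def)
      have mono: "measure M (ball x r) \<le> measure M (ball x s)"
        using s by (intro measure_mono_ball subset_ball) auto
      have V: "0 < emeasure M (ball x r)" "emeasure M (ball x r) < \<infinity>"
        "0 < emeasure M (ball x s)" "emeasure M (ball x s) < \<infinity>"
        using pos mono by (auto simp: emeasure_ball ennreal_less_zero_iff)
      have est: "lp_mean M q W B' (T t (restr B f)) \<le>
          ennreal (C * (C0 ^ k * Cu powr (a - b) * (2 ^ k * r / sqrt t) powr \<tau>)
             * exp (- (c * d\<^sup>2 / t))) * lp_mean M p V B f"
        if "B \<in> sets M" "B \<subseteq> E" "closed E" "B' \<in> sets M" "B' \<subseteq> F" "closed F" "0 \<le> d"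
          "E \<noteq> {} \<Longrightarrow> F \<noteq> {} \<Longrightarrow> d \<le> setdist E F"
          and VV: "0 < emeasure M V" "emeasure M V < \<infinity>" "0 < emeasure M W" "emeasure M W < \<infinity>"
            "measure M V \<le> measure M (ball x (2 ^ k * r))" "measure M (ball x r) \<le> measure M W"
        for B B' E F V W d k
      proof -
        have "C * t powr - (\<tau> / 2) * exp (- (c * d\<^sup>2 / t)) * (measure M V powr a * measure M W powr - b)
          = C * exp (- (c * d\<^sup>2 / t)) * (t powr - (\<tau> / 2) * (measure M V powr a * measure M W powr - b))"
          by simp
        also have "\<dots> \<le> C * exp (- (c * d\<^sup>2 / t)) *
            (C0 ^ k * Cu powr (a - b) * (2 ^ k * r / sqrt t) powr \<tau>)"
          unfolding \<tau>_def using C r ab that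
          by (intro mult_left_mono volume_factor[OF Cu vol _ _ _ r t _ _ pos]) auto
        finally have "C * t powr - (\<tau> / 2) * exp (- (c * d\<^sup>2 / t)) * (measure M V powr a * measure M W powr - b)
          \<le> C * (C0 ^ k * Cu powr (a - b) * (2 ^ k * r / sqrt t) powr \<tau>) * exp (- (c * d\<^sup>2 / t))"
          by (simp add: ac_simps)
        moreover have "lp_mean M q W B' (T t (restr B f))
          \<le> ennreal (C * t powr - (\<tau> / 2) * exp (- (c * d\<^sup>2 / t)) *
             (measure M V powr a * measure M W powr - b)) * lp_mean M p V B f"
          unfolding a_def b_def
          by (rule full_off_diagonal_imp_lp_mean_le[where E = E and F = F, OF fod D S f t C c p q]) (use that in auto)
        ultimately show ?thesis
          by (elim order_trans) (intro mult_right_mono ennreal_leI, auto)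
      qed
      have ?est1
      proof -
        have "lp_mean M q (ball x r) (ball x r) (T t (restr (ball x r) f)) \<le>
          ennreal (C * (C0 ^ 0 * Cu powr (a - b) * (2 ^ 0 * r / sqrt t) powr \<tau>)
             * exp (- (c * 0\<^sup>2 / t))) * lp_mean M p (ball x r) (ball x r) f"
          \<comment> \<open>The closed ball serves as both enclosing sets. The distance bound is
            \<open>0\<close> and \<open>k = 0\<close>, so neither Gaussian decay nor doubling loss
            appears.\<close>
          using V by (intro est[of "ball x r" "cball x r" "ball x r" "cball x r"]) auto
        also have "\<dots> \<le> ennreal (K * Upsilon (r / sqrt t) powr \<tau>) * lp_mean M p (ball x r) (ball x r) f"
        proof (intro mult_right_mono ennreal_leI)
          have "1 * Cu powr (a - b) * 1 \<le> C0 * Cu powr (a - b) * 2 powr \<tau>"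
            using C0 \<tau> by (intro mult_mono ge_one_powr_ge_zero) auto
          moreover have "(r / sqrt t) powr \<tau> \<le> Upsilon (r / sqrt t) powr \<tau>"
            using r t \<tau> by (intro powr_mono2 Upsilon_ge) auto
          ultimately have "(Cu powr (a - b)) * (r / sqrt t) powr \<tau>
              \<le> (C0 * Cu powr (a - b) * 2 powr \<tau>) * Upsilon (r / sqrt t) powr \<tau>"
            using C0 by (intro mult_mono) auto
          from mult_left_mono[OF this, of C]
          show "C * (C0 ^ 0 * Cu powr (a - b) * (2 ^ 0 * r / sqrt t) powr \<tau>) * exp (- (c * 0\<^sup>2 / t))
            \<le> K * Upsilon (r / sqrt t) powr \<tau>"
            using C by (simp add: K_def ac_simps)
        qed auto
        finally show ?thesis .
      qed
      moreover have "?est2 \<and> ?est3" if j: "2 \<le> j"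
      proof -
        \<comment> \<open>A point outside the ball of radius \<open>2 ^ j * r\<close> has distance
          at least \<open>(2 ^ j - 1) * r\<close> from the closed ball of radius \<open>r\<close>.
          As \<open>j \<ge> 2\<close>, this is at least \<open>d\<close>; squaring
          \<open>3 / 4\<close> produces the \<open>9 / 16\<close> in the Gaussian constant.\<close>
        define d where "d = 3 / 4 * 2 ^ j * r"
        \<comment> \<open>Keeping the outer sphere and removing an open ball gives a closed set
          around the annulus, still at distance \<open>d\<close> from the closed ball.\<close>
        define E where "E = cball x s - ball x (2 ^ j * r)"
        have E: "closed E" "?A j x r \<subseteq> E"
          unfolding E_def dyadic_annulus_def s_def by (auto intro!: closed_Diff)
        have d0: "0 \<le> d" using r by (simp add: d_def)
        have "d \<le> dist u v" if "u \<in> E" "v \<in> cball x r" for u v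
        proof -
          have "(4::real) \<le> 2 ^ j" using power_increasing[OF j, of "2::real"] by simp
          then have "4 * r \<le> 2 ^ j * r" using r by (intro mult_right_mono) auto
          then have "d \<le> 2 ^ j * r - r" unfolding d_def by linarith
          also have "\<dots> \<le> dist x u - dist x v" using that by (auto simp: E_def)
          also have "\<dots> \<le> dist u v" using dist_triangle[of x u v] by (simp add: dist_commute)
          finally show ?thesis .
        qed
        then have dist: "d \<le> setdist E (cball x r)" if "E \<noteq> {}"
          using that r by (intro le_setdistI) auto
        have bound: "C * (C0 ^ (j + 1) * Cu powr (a - b) * (2 ^ (j + 1) * r / sqrt t) powr \<tau>)
             * exp (- (c * d\<^sup>2 / t))
          \<le> K * 2 powr (real j * log 2 C0) * Upsilon (2 ^ j * r / sqrt t) powr \<tau>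
              * exp (- (c * 9 / 16 * 4 ^ j * r\<^sup>2 / t))"
        proof -
          \<comment> \<open>This identity fixes the choice
            \<open>\<theta>1 = log 2 C0\<close>.\<close>
          have "C0 ^ j = 2 powr (real j * log 2 C0)"
            using C0 by (simp add: powr_powr[symmetric] powr_realpow mult.commute[of "real j"])
          moreover have "(2 ^ (j + 1) * r / sqrt t) powr \<tau> = 2 powr \<tau> * (2 ^ j * r / sqrt t) powr \<tau>"
            using r t by (simp add: powr_mult[symmetric] mult.assoc)
          moreover have "c * d\<^sup>2 / t = c * 9 / 16 * 4 ^ j * r\<^sup>2 / t"
            by (simp add: d_def power_mult_distrib power_divide power2_eq_square[of "2 ^ j"]
               power_mult_distrib[symmetric])
          moreover have "(2 ^ j * r / sqrt t) powr \<tau> \<le> Upsilon (2 ^ j * r / sqrt t) powr \<tau>"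
            using r t \<tau> by (intro powr_mono2 Upsilon_ge) auto
          then have "K * 2 powr (real j * log 2 C0) * (2 ^ j * r / sqrt t) powr \<tau>
              * exp (- (c * 9 / 16 * 4 ^ j * r\<^sup>2 / t))
            \<le> K * 2 powr (real j * log 2 C0) * Upsilon (2 ^ j * r / sqrt t) powr \<tau>
              * exp (- (c * 9 / 16 * 4 ^ j * r\<^sup>2 / t))"
            using K by (intro mult_right_mono mult_left_mono) auto
          ultimately show ?thesis by (simp add: K_def ac_simps)
        qed
        have e2: "lp_mean M q (ball x r) (ball x r) (T t (restr (?A j x r) f))
          \<le> ennreal (C * (C0 ^ (j + 1) * Cu powr (a - b) * (2 ^ (j + 1) * r / sqrt t) powr \<tau>)
             * exp (- (c * d\<^sup>2 / t))) * lp_mean M p (ball x s) (?A j x r) f"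
          using V E d0 dist
          by (intro est[of "?A j x r" E "ball x r" "cball x r"]) (auto simp: s_def)
        have e3: "lp_mean M q (ball x s) (?A j x r) (T t (restr (ball x r) f))
          \<le> ennreal (C * (C0 ^ (j + 1) * Cu powr (a - b) * (2 ^ (j + 1) * r / sqrt t) powr \<tau>)
             * exp (- (c * d\<^sup>2 / t))) * lp_mean M p (ball x r) (ball x r) f"
          using V E d0 dist mono
          by (intro est[of "ball x r" "cball x r" "?A j x r" E])
             (auto simp: s_def setdist_sym[of _ E])
        note bound' = mult_right_mono[OF ennreal_leI[OF bound] zero_le]
        show ?thesis
          using order_trans[OF e2 bound'] order_trans[OF e3 bound'] unfolding s_def by blast
      qed
      ultimately show ?thesis by blast
    qed
    then show ?est1 "2 \<le> j \<Longrightarrow> ?est2" "2 \<le> j \<Longrightarrow> ?est3" by blast+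
  qed
  then show ?thesis
    unfolding off_diagonal_on_balls_def
    using C0 \<tau> c K
    by (intro exI[of _ "log 2 C0"] exI[of _ \<tau>] exI[of _ "c * 9 / 16"] exI[of _ K] conjI allI impI ballI)
       simp_all
qed

end

section \<open>Separated sets\<close>

text \<open>Zorn's lemma gives a maximal separated set. Its balls cover the space, since an
  uncovered point could be added to it.\<close>

lemma maximal_separated_set:
  fixes r :: real
  assumes "0 < r"
  obtains S :: "'a::metric_space set"
    where "pairwise (\<lambda>x y. r \<le> dist x y) S" "\<And>x. \<exists>s\<in>S. x \<in> ball s r"
proof -
  let ?A = "{S :: 'a set. pairwise (\<lambda>x y. r \<le> dist x y) S}"
  have "\<exists>S\<in>?A. \<forall>X\<in>?A. S \<subseteq> X \<longrightarrow> X = S"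
  proof (rule subset_Zorn')
    fix \<C> assume "subset.chain ?A \<C>"
    then show "\<Union>\<C> \<in> ?A"
      by (auto intro!: pairwise_chain_Union simp: subset_chain_def chain_subset_def)
  qed
  then obtain S where S: "pairwise (\<lambda>x y. r \<le> dist x y) S"
    and max: "\<forall>X\<in>?A. S \<subseteq> X \<longrightarrow> X = S"
    by blast
  have "\<exists>s\<in>S. x \<in> ball s r" for x
  proof (rule ccontr)
    assume *: "\<not> (\<exists>s\<in>S. x \<in> ball s r)"
    then have "pairwise (\<lambda>x y. r \<le> dist x y) (insert x S)"
      using S by (auto simp: pairwise_insert not_less dist_commute)
    with max have "insert x S = S" by blast
    then have "x \<in> S" by auto
    with * assms show False by auto
  qed
  with S that show ?thesis by blast
qed

context doubling_space
begin

text \<open>A packing argument. The balls of radius \<open>r / 2\<close> about the selected centres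
  are disjoint and lie in \<open>ball y (2 ^ (k + 1) * r)\<close>, while doubling gives each of them
  at least the fraction \<open>1 / C0 ^ (k + 3)\<close> of its volume. This bounds all finite
  subsets uniformly, which also yields finiteness.\<close>

lemma separated_card:
  fixes S :: "'a set"
  assumes pos: "\<And>x r. 0 < r \<Longrightarrow> 0 < measure M (ball x r)" and r: "0 < r"
    and S: "pairwise (\<lambda>x y. r \<le> dist x y) S"
  shows "finite {s\<in>S. y \<in> ball s (2 ^ k * r)}"
    and "real (card {s\<in>S. y \<in> ball s (2 ^ k * r)}) \<le> C0 ^ (k + 3)"
proof -
  let ?S = "{s\<in>S. y \<in> ball s (2 ^ k * r)}"
  let ?m = "\<lambda>x s. measure M (ball x s)"
  have card: "real (card K) \<le> C0 ^ (k + 3)" if K: "K \<subseteq> ?S" "finite K" for K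
  proof -
    define Y where "Y = ?m y (2 ^ (k + 1) * r)"
    have Y: "0 < Y" unfolding Y_def using r by (intro pos) auto
    have r2: "r \<le> 2 ^ k * r" using r by simp
    have "Y \<le> C0 ^ (k + 3) * ?m s (r / 2)" if s: "s \<in> K" for s
    proof -
      \<comment> \<open>The ball about \<open>y\<close> reaches less than
        \<open>3 * 2 ^ k * r\<close> from \<open>s\<close>, which is below
        \<open>2 ^ (k + 2) * r\<close>. That radius is \<open>k + 3\<close> doublings of
        \<open>r / 2\<close>.\<close>
      have "Y \<le> ?m s (2 ^ (k + 3) * (r / 2))"
        unfolding Y_def
      proof (rule measure_mono_ball)
        show "ball y (2 ^ (k + 1) * r) \<subseteq> ball s (2 ^ (k + 3) * (r / 2))"
        proof
          fix z assume "z \<in> ball y (2 ^ (k + 1) * r)"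
          moreover have "dist s y < 2 ^ k * r" using s K by auto
          moreover have "2 ^ (k + 3) * (r / 2) = 2 * (2 ^ (k + 1) * r)"
            by (simp add: power_add)
          moreover have "2 ^ k * r \<le> 2 ^ (k + 1) * r"
            using r by simp
          ultimately show "z \<in> ball s (2 ^ (k + 3) * (r / 2))"
            using dist_triangle[of s z y] unfolding mem_ball by linarith
        qed
      qed auto
      also have "\<dots> \<le> C0 ^ (k + 3) * ?m s (r / 2)"
        using r by (intro doubling_pow) auto
      finally show ?thesis .
    qed
    then have "(\<Sum>s\<in>K. Y) \<le> (\<Sum>s\<in>K. C0 ^ (k + 3) * ?m s (r / 2))"
      by (rule sum_mono)
    also have "\<dots> = C0 ^ (k + 3) * measure M (\<Union>s\<in>K. ball s (r / 2))"
    proof -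
      have "disjoint_family_on (\<lambda>s. ball s (r / 2)) K"
        unfolding disjoint_family_on_def
      proof (intro ballI impI)
        fix s u assume "s \<in> K" "u \<in> K" "s \<noteq> u"
        then have "r \<le> dist s u" using S K by (auto simp: pairwise_def)
        then show "ball s (r / 2) \<inter> ball u (r / 2) = {}"
          by (intro disjoint_ballI) simp
      qed
      then have "measure M (\<Union>s\<in>K. ball s (r / 2)) = (\<Sum>s\<in>K. ?m s (r / 2))"
        using K by (intro measure_finite_Union) (auto simp: emeasure_ball)
      then show ?thesis by (simp add: sum_distrib_left)
    qed
    also have "\<dots> \<le> C0 ^ (k + 3) * Y"
      unfolding Y_def
    proof (intro mult_left_mono measure_mono_ball)
      show "(\<Union>s\<in>K. ball s (r / 2)) \<subseteq> ball y (2 ^ (k + 1) * r)"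
      proof safe
        fix s z assume "s \<in> K" and z: "z \<in> ball s (r / 2)"
        then have "dist s y < 2 ^ k * r" using K by auto
        moreover have "2 ^ (k + 1) * r = 2 ^ k * r + 2 ^ k * r"
          by simp
        ultimately show "z \<in> ball y (2 ^ (k + 1) * r)"
          using z dist_triangle[of y z s] r2 r unfolding mem_ball dist_commute[of y s] by linarith
      qed
    qed (use C0 K in auto)
    finally show ?thesis using Y by simp
  qed
  then have "card K \<le> nat \<lfloor>C0 ^ (k + 3)\<rfloor>" if "K \<subseteq> ?S" "finite K" for K
    using card[OF that] by (simp add: le_nat_floor)
  from finite_if_finite_subsets_card_bdd[OF this] show "finite ?S" by blast
  then show "real (card ?S) \<le> C0 ^ (k + 3)" by (intro card) auto
qed

lemma separated_countable:
  fixes S :: "'a set"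
  assumes "\<And>x r. 0 < r \<Longrightarrow> 0 < measure M (ball x r)" and r: "0 < r"
    and "pairwise (\<lambda>x y. r \<le> dist x y) S"
  shows "countable S"
proof -
  \<comment> \<open>Here \<open>undefined\<close> is merely a fixed base point. The dyadic balls
    about each centre eventually contain it, so \<open>S\<close> is a countable union of the finite
    sets counted above.\<close>
  have "S \<subseteq> (\<Union>k. {s\<in>S. undefined \<in> ball s (2 ^ k * r)})"
  proof
    fix s assume "s \<in> S"
    obtain k where "dist s undefined / r < 2 ^ k"
      using real_arch_pow[of 2 "dist s undefined / r"] by auto
    with r \<open>s \<in> S\<close> show "s \<in> (\<Union>k. {s\<in>S. undefined \<in> ball s (2 ^ k * r)})"
      by (auto simp: field_simps)
  qed
  moreover have "countable (\<Union>k. {s\<in>S. undefined \<in> ball s (2 ^ k * r)})"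
    using separated_card(1)[OF assms] by (auto intro: countable_finite)
  ultimately show ?thesis by (rule countable_subset)
qed

end

text \<open>The inequality \<open>x / m \<le> exp (x / m)\<close> with
  \<open>x = \<gamma> * 4 ^ i\<close> bounds \<open>exp (- x)\<close> by \<open>(m / x) ^ m\<close>.
  Taking \<open>m\<close> with \<open>2 * A < 4 ^ m\<close> makes the ratio at most
  \<open>1 / 2\<close>, so a geometric series dominates.\<close>

lemma summable_exp_neg_4_power:
  fixes A \<gamma> :: real
  assumes "0 \<le> A" "0 < \<gamma>"
  shows "summable (\<lambda>i. A ^ i * exp (- (\<gamma> * 4 ^ i)))"
proof -
  obtain k where "2 * A < 4 ^ k"
    using real_arch_pow[of 4 "2 * A"] by auto
  then obtain m where m: "2 * A < 4 ^ m" "0 < m"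
    using power_increasing[of k "Suc k" "4 :: real"] by (meson less_le_trans le_SucI order_refl zero_less_Suc one_le_numeral)
  have "norm (A ^ i * exp (- (\<gamma> * 4 ^ i))) \<le> (m / \<gamma>) ^ m * (1 / 2) ^ i" for i
  proof -
    have "\<gamma> * 4 ^ i / m \<le> exp (\<gamma> * 4 ^ i / m)"
      using exp_ge_add_one_self[of "\<gamma> * 4 ^ i / m"] by linarith
    then have "(\<gamma> * 4 ^ i / m) ^ m \<le> exp (\<gamma> * 4 ^ i / m) ^ m"
      using assms by (intro power_mono) auto
    also have "\<dots> = exp (\<gamma> * 4 ^ i)"
      using m by (simp add: exp_of_nat_mult[symmetric])
    finally have "exp (- (\<gamma> * 4 ^ i)) \<le> 1 / (\<gamma> * 4 ^ i / m) ^ m"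
      using assms m by (simp add: exp_minus field_simps)
    then have "A ^ i * exp (- (\<gamma> * 4 ^ i)) \<le> A ^ i * (1 / (\<gamma> * 4 ^ i / m) ^ m)"
      using assms by (intro mult_left_mono) auto
    also have "\<dots> = (m / \<gamma>) ^ m * (A / 4 ^ m) ^ i"
      using assms by (simp add: power_mult_distrib power_divide power_mult[symmetric] mult.commute)
    also have "\<dots> \<le> (m / \<gamma>) ^ m * (1 / 2) ^ i"
      using assms m by (intro mult_left_mono power_mono) (auto simp: field_simps)
    finally show ?thesis using assms by simp
  qed
  moreover have "summable (\<lambda>i. (m / \<gamma>) ^ m * (1 / 2 :: real) ^ i)"
    by (intro summable_mult summable_geometric) auto
  ultimately show ?thesis by (rule summable_comparison_test'[rotated])
qed

section \<open>From balls to full estimates\<close>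

lemma lp_norm_AE_le:
  assumes "q = \<infinity>"
  shows "AE y in M. y \<in> A \<longrightarrow> ennreal (norm (g y)) \<le> lp_norm M q A g"
  using esssup_AE[where M = M and f = "\<lambda>x. ennreal (norm (g x)) * indicator A x"] assms
  by (auto simp: lp_norm_def elim!: eventually_mono)

lemma lp_norm_infinity_le:
  assumes "q = \<infinity>" and [measurable]: "g \<in> borel_measurable M" "A \<in> sets M"
    and "AE y in M. y \<in> A \<longrightarrow> ennreal (norm (g y)) \<le> K"
  shows "lp_norm M q A g \<le> K"
  unfolding lp_norm_def using assms(1,4)
  by (auto intro!: esssup_I elim!: eventually_mono split: split_indicator)

text \<open>Fatou's lemma for finite \<open>q\<close>. For \<open>q = \<infinity>\<close> the bounds
  for all \<open>k\<close> hold outside one common null set and pass to the \<open>liminf\<close>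
  pointwise.\<close>

lemma lp_norm_liminf_le:
  fixes g :: "'a \<Rightarrow> 'k::{real_normed_field, second_countable_topology}"
  assumes [measurable]: "g \<in> borel_measurable M" "\<And>k. h k \<in> borel_measurable M" "A \<in> sets M"
    and lim: "AE y in M. ennreal (norm (g y)) \<le> liminf (\<lambda>k. ennreal (norm (h k y)))"
    and K: "\<And>k::nat. lp_norm M q A (h k) \<le> K" and q: "0 < q"
  shows "lp_norm M q A g \<le> K"
proof (cases "q = \<infinity>")
  case True
  have "AE y in M. \<forall>k. y \<in> A \<longrightarrow> ennreal (norm (h k y)) \<le> lp_norm M q A (h k)"
    unfolding AE_all_countable using lp_norm_AE_le[OF True] by blast
  with lim show ?thesis
  proof (intro lp_norm_infinity_le[OF True], simp_all, eventually_elim, intro impI)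
    fix y assume y: "ennreal (norm (g y)) \<le> liminf (\<lambda>k. ennreal (norm (h k y)))"
      "\<forall>k. y \<in> A \<longrightarrow> ennreal (norm (h k y)) \<le> lp_norm M q A (h k)" "y \<in> A"
    have "liminf (\<lambda>k. ennreal (norm (h k y))) \<le> K"
      using y K by (intro Liminf_le always_eventually) (auto intro: order_trans)
    with y show "ennreal (norm (g y)) \<le> K" by simp
  qed
next
  case False
  define Q where "Q = enn2real q"
  have Q: "0 < Q" using q False by (simp add: Q_def enn2real_positive_iff less_top)
  \<comment> \<open>The power passes inside the \<open>liminf\<close>: a strict lower bound for the
    \<open>Q\<close>-th power becomes one for the norm under the increasing map
    \<open>1 / Q\<close>, and is then raised back to the power \<open>Q\<close>.\<close>
  have "ennreal (norm (g y) powr Q) \<le> liminf (\<lambda>k. ennreal (norm (h k y) powr Q))"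
    if "ennreal (norm (g y)) \<le> liminf (\<lambda>k. ennreal (norm (h k y)))" for y
    unfolding le_Liminf_iff
  proof (intro allI impI)
    fix z assume z: "z < ennreal (norm (g y) powr Q)"
    then obtain w where w: "z = ennreal w" "0 \<le> w" by (cases z) auto
    then have "w < norm (g y) powr Q" using z by (simp add: ennreal_less_iff)
    then have "w powr (1 / Q) < (norm (g y) powr Q) powr (1 / Q)"
      using w Q by (intro powr_less_mono2) auto
    then have "ennreal (w powr (1 / Q)) < ennreal (norm (g y))"
      using Q by (simp add: powr_powr ennreal_less_iff)
    with that have "\<forall>\<^sub>F k in sequentially. ennreal (w powr (1 / Q)) < ennreal (norm (h k y))"
      unfolding le_Liminf_iff by blast
    then show "\<forall>\<^sub>F k in sequentially. z < ennreal (norm (h k y) powr Q)"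
    proof eventually_elim
      case (elim k)
      then have "(w powr (1 / Q)) powr Q < norm (h k y) powr Q"
        using Q by (intro powr_less_mono2) (auto simp: ennreal_less_iff)
      then show ?case using w Q by (simp add: powr_powr ennreal_less_iff)
    qed
  qed
  then have "(\<integral>\<^sup>+y\<in>A. ennreal (norm (g y) powr Q) \<partial>M)
      \<le> (\<integral>\<^sup>+y. liminf (\<lambda>k. ennreal (norm (h k y) powr Q) * indicator A y) \<partial>M)"
    using lim by (intro nn_integral_mono_AE)
      (auto elim!: eventually_mono split: split_indicator)
  also have "\<dots> \<le> liminf (\<lambda>k. \<integral>\<^sup>+y\<in>A. ennreal (norm (h k y) powr Q) \<partial>M)"
    by (intro nn_integral_liminf) simp
  also have "\<dots> \<le> ennreal_powr K Q"
    using K unfolding lp_norm_le_iff[OF False q] Q_def[symmetric]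
    by (intro Liminf_le always_eventually) auto
  finally show ?thesis
    unfolding lp_norm_le_iff[OF False q] Q_def .
qed

text \<open>Replaces Minkowski's inequality: a geometric loss \<open>2 ^ (k + 1)\<close> in the \<open>k\<close>-th term is
  harmless because the coefficients decay faster than any geometric sequence.\<close>

lemma powr_le_sum_geometric:
  fixes u :: "nat \<Rightarrow> real"
  assumes "\<And>k. 0 \<le> u k" "0 \<le> g" "g \<le> (\<Sum>k\<le>J. u k)" "0 < Q"
  shows "ennreal (g powr Q) \<le> (\<Sum>k. ennreal ((2 ^ (k + 1) * u k) powr Q))"
proof -
  \<comment> \<open>With \<open>m\<close> the index of the largest weighted term \<open>v\<close>,
    every \<open>u k\<close> is at most \<open>v / 2 ^ (k + 1)\<close>. These bounds add up to at
    most \<open>v\<close>, so a single term of the series already dominates.\<close>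
  obtain m where m: "Max ((\<lambda>k. 2 ^ (k + 1) * u k) ` {..J}) = 2 ^ (m + 1) * u m"
    by (rule obtains_MAX[of "{..J}" "\<lambda>k. 2 ^ (k + 1) * u k"]) auto
  define v where "v = 2 ^ (m + 1) * u m"
  have "u k \<le> v * (1 / 2) ^ (k + 1)" if "k \<le> J" for k
  proof -
    have "2 ^ (k + 1) * u k \<le> v"
      unfolding v_def m[symmetric] using that by (intro Max_ge) auto
    then show ?thesis by (simp add: power_divide field_simps)
  qed
  then have "g \<le> (\<Sum>k\<le>J. v * (1 / 2) ^ (k + 1))"
    by (intro order_trans[OF assms(3)] sum_mono) auto
  also have "\<dots> = v * (1 - (1 / 2) ^ (J + 1))"
    by (induction J) (auto simp: algebra_simps)
  also have "\<dots> \<le> v * 1"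
    using assms by (intro mult_left_mono) (auto simp: v_def)
  finally have "g powr Q \<le> v powr Q"
    using assms by (intro powr_mono2) auto
  then have "ennreal (g powr Q) \<le> ennreal (v powr Q)" by (rule ennreal_leI)
  also have "\<dots> = (\<Sum>k\<in>{m}. ennreal ((2 ^ (k + 1) * u k) powr Q))"
    by (simp add: v_def)
  also have "\<dots> \<le> (\<Sum>k. ennreal ((2 ^ (k + 1) * u k) powr Q))"
    by (intro sum_le_suminf) auto
  finally show ?thesis .
qed

section \<open>Patching local estimates over a separated cover\<close>

context doubling_space
begin

text \<open>Sums the local \<open>Q\<close>-th power integrals over all centres. In
  \<open>sm\<close> the factor \<open>2 ^ (i + 1)\<close> is the price of splitting the sum of
  pieces, and \<open>C0 ^ (i + 5)\<close> bounds the overlap of the balls of radius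
  \<open>2 ^ (i + 2) * r\<close>.\<close>

lemma lp_norm_patch_finite:
  fixes S :: "'a set" and g h :: "'a \<Rightarrow> 'k::{real_normed_field, second_countable_topology}"
    and G :: "'a \<Rightarrow> nat \<Rightarrow> 'a \<Rightarrow> 'k"
  assumes pos: "\<And>x r. 0 < r \<Longrightarrow> 0 < measure M (ball x r)" and r: "0 < r"
    and S: "pairwise (\<lambda>x y. r \<le> dist x y) S" and cover: "\<And>x. \<exists>s\<in>S. x \<in> ball s r"
    and p: "0 < p" and pq: "p < q" and q: "q \<noteq> \<infinity>"
    and [measurable]: "g \<in> borel_measurable M" "h \<in> borel_measurable M"
      "\<And>s i. G s i \<in> borel_measurable M"
    and F [measurable]: "F \<in> sets M"
    and g: "\<And>s. s \<in> S \<Longrightarrow> AE y in M. norm (g y) \<le> (\<Sum>k\<le>J s. norm (G s k y))"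
    and G: "\<And>s i. s \<in> S \<Longrightarrow> lp_norm M q (ball s r \<inter> F) (G s i)
        \<le> ennreal (\<kappa> * w i) * lp_norm M p (ball s (2 ^ (i + 2) * r)) h"
    and \<kappa>: "0 \<le> \<kappa>" and w: "\<And>i. 0 \<le> w i"
    and sm: "summable (\<lambda>i. (2 ^ (i + 1) * w i) powr enn2real q * C0 ^ (i + 5))"
  shows "lp_norm M q F g
    \<le> ennreal (\<kappa> * (\<Sum>i. (2 ^ (i + 1) * w i) powr enn2real q * C0 ^ (i + 5)) powr (1 / enn2real q))
       * lp_norm M p UNIV h"
proof -
  define P Q where "P = enn2real p" and "Q = enn2real q"
  have pf: "p \<noteq> \<infinity>" and q0: "0 < q" using pq p by auto
  have P: "0 < P" and PQ: "P < Q"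
    using p pq q pf by (auto simp: P_def Q_def enn2real_positive_iff less_top enn2real_less_iff)
  define N where "N = lp_norm M p UNIV h"
  define I where "I = (\<lambda>A. \<integral>\<^sup>+y\<in>A. ennreal (norm (h y) powr P) \<partial>M)"
  define L where "L = (\<lambda>A f. \<integral>\<^sup>+y\<in>A. ennreal (norm (f y :: 'k) powr Q) \<partial>M)"
  have IN: "ennreal_powr (lp_norm M p A h) P = I A" for A
    using P pf by (simp add: lp_norm_finite I_def P_def ennreal_powr_powr)
  have cS: "countable S" by (rule separated_countable[OF pos r S])
  have [measurable]: "ball s r \<inter> F \<in> sets M" "ball s \<rho> \<in> sets M" for s \<rho>
    using F by auto
  define Z where "Z = (\<lambda>i. (2 ^ (i + 1) * w i) powr Q * C0 ^ (i + 5))"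
  have Z0: "0 \<le> Z i" for i using C0 by (simp add: Z_def)
  have piece: "L (ball s r \<inter> F) (G s i)
      \<le> ennreal ((\<kappa> * w i) powr Q) * (ennreal_powr N (Q - P) * I (ball s (2 ^ (i + 2) * r)))"
    if s: "s \<in> S" for s i
  proof -
    txt \<open>Since \<open>p < q\<close>, all but \<open>P\<close> of the \<open>Q\<close> powers of the local norm are bounded by the global
      one; the remaining \<open>P\<close> make the sum over \<open>S\<close> additive.\<close>
    define n where "n = lp_norm M p (ball s (2 ^ (i + 2) * r)) h"
    have "n \<le> N" unfolding n_def N_def by (intro lp_norm_mono) auto
    have "L (ball s r \<inter> F) (G s i) \<le> ennreal_powr (ennreal (\<kappa> * w i) * n) Q"
      using G[OF s, of i] unfolding lp_norm_le_iff[OF q q0] L_def Q_def n_def .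
    also have "\<dots> = ennreal ((\<kappa> * w i) powr Q) * ennreal_powr n ((Q - P) + P)"
      using \<kappa> w by (simp add: ennreal_powr_mult)
    also have "\<dots> = ennreal ((\<kappa> * w i) powr Q) * (ennreal_powr n (Q - P) * I (ball s (2 ^ (i + 2) * r)))"
      unfolding ennreal_powr_add IN[symmetric] n_def ..
    also have "\<dots> \<le> ennreal ((\<kappa> * w i) powr Q) * (ennreal_powr N (Q - P) * I (ball s (2 ^ (i + 2) * r)))"
      using PQ \<open>n \<le> N\<close> by (intro mult_left_mono mult_right_mono ennreal_powr_mono) auto
    finally show ?thesis .
  qed
  have local: "L (ball s r \<inter> F) g \<le> (\<Sum>i. ennreal ((\<kappa> * (2 ^ (i + 1) * w i)) powr Q) *
       (ennreal_powr N (Q - P) * I (ball s (2 ^ (i + 2) * r))))" if s: "s \<in> S" for s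
  proof -
    have "L (ball s r \<inter> F) g
      \<le> (\<integral>\<^sup>+y. (\<Sum>i. ennreal ((2 ^ (i + 1) * norm (G s i y)) powr Q) * indicator (ball s r \<inter> F) y) \<partial>M)"
      unfolding L_def
    proof (intro nn_integral_mono_AE, use g[OF s] in eventually_elim)
      fix y assume "norm (g y) \<le> (\<Sum>k\<le>J s. norm (G s k y))"
      then have "ennreal (norm (g y) powr Q) \<le> (\<Sum>k. ennreal ((2 ^ (k + 1) * norm (G s k y)) powr Q))"
        using P PQ by (intro powr_le_sum_geometric) auto
      then show "ennreal (norm (g y) powr Q) * indicator (ball s r \<inter> F) y
        \<le> (\<Sum>i. ennreal ((2 ^ (i + 1) * norm (G s i y)) powr Q) * indicator (ball s r \<inter> F) y)"
        by (auto split: split_indicator)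
    qed
    also have "\<dots> = (\<Sum>i. \<integral>\<^sup>+y. ennreal ((2 ^ (i + 1) * norm (G s i y)) powr Q) * indicator (ball s r \<inter> F) y \<partial>M)"
      by (intro nn_integral_suminf) measurable
    also have "\<dots> = (\<Sum>i. ennreal ((2 ^ (i + 1)) powr Q) * L (ball s r \<inter> F) (G s i))"
      unfolding L_def
      by (subst nn_integral_cmult[symmetric])
         (auto simp: powr_mult ennreal_mult mult.assoc simp del: power_Suc)
    also have "\<dots> \<le> (\<Sum>i. ennreal ((\<kappa> * (2 ^ (i + 1) * w i)) powr Q) *
       (ennreal_powr N (Q - P) * I (ball s (2 ^ (i + 2) * r))))"
    proof (intro suminf_le)
      fix i
      have "ennreal ((2 ^ (i + 1)) powr Q) * L (ball s r \<inter> F) (G s i)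
        \<le> ennreal ((2 ^ (i + 1)) powr Q) *
          (ennreal ((\<kappa> * w i) powr Q) * (ennreal_powr N (Q - P) * I (ball s (2 ^ (i + 2) * r))))"
        by (intro mult_left_mono piece s) auto
      also have "\<dots> = ennreal ((\<kappa> * (2 ^ (i + 1) * w i)) powr Q) *
       (ennreal_powr N (Q - P) * I (ball s (2 ^ (i + 2) * r)))"
        using \<kappa> w by (simp add: powr_mult ennreal_mult ac_simps del: power_Suc)
      finally show "ennreal ((2 ^ (i + 1)) powr Q) * L (ball s r \<inter> F) (G s i)
        \<le> ennreal ((\<kappa> * (2 ^ (i + 1) * w i)) powr Q) *
          (ennreal_powr N (Q - P) * I (ball s (2 ^ (i + 2) * r)))" .
    qed auto
    finally show ?thesis .
  qed
  \<comment> \<open>Countability of \<open>S\<close> allows the sum over centres to be moved inside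
    the integral, where it counts the enlarged balls containing \<open>y\<close>. The packing bound
    with \<open>k = i + 2\<close> gives the exponent \<open>i + 5\<close>.\<close>
  have overlap: "(\<integral>\<^sup>+s. I (ball s (2 ^ (i + 2) * r)) \<partial>count_space S) \<le> ennreal (C0 ^ (i + 5)) * ennreal_powr N P" for i
  proof -
    let ?R = "2 ^ (i + 2) * r"
    have count: "(\<integral>\<^sup>+s. indicator (ball s ?R) y \<partial>count_space S) \<le> ennreal (C0 ^ (i + 5))" for y
    proof -
      let ?T = "{s\<in>S. y \<in> ball s ?R}"
      note card = separated_card[OF pos r S, of y "i + 2"]
      have "(\<integral>\<^sup>+s. indicator (ball s ?R) y \<partial>count_space S) = (\<integral>\<^sup>+s. indicator ?T s \<partial>count_space S)"
        by (intro nn_integral_cong) (auto split: split_indicator)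
      also have "\<dots> = emeasure (count_space S) ?T"
        by (intro nn_integral_indicator) auto
      also have "\<dots> = ennreal (real (card ?T))"
        using card(1) by (subst emeasure_count_space_finite) (auto simp: ennreal_of_nat_eq_real_of_nat)
      also have "\<dots> \<le> ennreal (C0 ^ (i + 5))"
        using card(2) by (intro ennreal_leI) (simp add: add.commute[of i])
      finally show ?thesis .
    qed
    have "(\<integral>\<^sup>+s. I (ball s ?R) \<partial>count_space S)
      = (\<integral>\<^sup>+y. \<integral>\<^sup>+s. ennreal (norm (h y) powr P) * indicator (ball s ?R) y \<partial>count_space S \<partial>M)"
      unfolding I_def by (intro nn_integral_count_space_nn_integral[symmetric] cS) measurable
    also have "\<dots> = (\<integral>\<^sup>+y. ennreal (norm (h y) powr P) * (\<integral>\<^sup>+s. indicator (ball s ?R) y \<partial>count_space S) \<partial>M)"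
      by (intro nn_integral_cong nn_integral_cmult) auto
    also have "\<dots> \<le> (\<integral>\<^sup>+y. ennreal (norm (h y) powr P) * ennreal (C0 ^ (i + 5)) \<partial>M)"
      by (intro nn_integral_mono mult_left_mono count) auto
    also have "\<dots> = ennreal (C0 ^ (i + 5)) * ennreal_powr N P"
      unfolding N_def IN I_def by (subst nn_integral_multc) (auto simp: mult.commute)
    finally show ?thesis .
  qed
  \<comment> \<open>Each point of \<open>F\<close> lies in some ball of the cover, so summing over
    all centres can only enlarge the integral.\<close>
  have "L F g \<le> (\<integral>\<^sup>+y. \<integral>\<^sup>+s. ennreal (norm (g y) powr Q) * indicator (ball s r \<inter> F) y \<partial>count_space S \<partial>M)"
    unfolding L_def
  proof (intro nn_integral_mono)
    fix y
    obtain s where s: "s \<in> S" "y \<in> ball s r" using cover[of y] by blast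
    have "ennreal (norm (g y) powr Q) * indicator (ball s r \<inter> F) y
      \<le> (\<integral>\<^sup>+s. ennreal (norm (g y) powr Q) * indicator (ball s r \<inter> F) y \<partial>count_space S)"
      by (rule nn_integral_ge_point[OF s(1)])
    with s show "ennreal (norm (g y) powr Q) * indicator F y
      \<le> (\<integral>\<^sup>+s. ennreal (norm (g y) powr Q) * indicator (ball s r \<inter> F) y \<partial>count_space S)"
      by (simp add: indicator_def)
  qed
  also have "\<dots> = (\<integral>\<^sup>+s. L (ball s r \<inter> F) g \<partial>count_space S)"
    unfolding L_def by (intro nn_integral_count_space_nn_integral cS) measurable
  also have "\<dots> \<le> (\<integral>\<^sup>+s. (\<Sum>i. ennreal ((\<kappa> * (2 ^ (i + 1) * w i)) powr Q) *
       (ennreal_powr N (Q - P) * I (ball s (2 ^ (i + 2) * r)))) \<partial>count_space S)"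
    by (intro nn_integral_mono local) simp
  also have "\<dots> = (\<Sum>i. ennreal ((\<kappa> * (2 ^ (i + 1) * w i)) powr Q) *
       (ennreal_powr N (Q - P) * (\<integral>\<^sup>+s. I (ball s (2 ^ (i + 2) * r)) \<partial>count_space S)))"
    by (simp add: nn_integral_suminf nn_integral_cmult del: power_Suc)
  also have "\<dots> \<le> (\<Sum>i. ennreal ((\<kappa> * (2 ^ (i + 1) * w i)) powr Q) *
       (ennreal_powr N (Q - P) * (ennreal (C0 ^ (i + 5)) * ennreal_powr N P)))"
    by (intro suminf_le mult_left_mono overlap) auto
  \<comment> \<open>The powers \<open>Q - P\<close> and \<open>P\<close> of the global norm
    recombine to \<open>Q\<close>, leaving only numerical weights under the sum.\<close>
  also have "\<dots> = (\<Sum>i. (ennreal (\<kappa> powr Q) * ennreal_powr N Q) * ennreal (Z i))"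
  proof -
    have NQ: "ennreal_powr N Q = ennreal_powr N (Q - P) * ennreal_powr N P"
      by (simp add: ennreal_powr_add[symmetric])
    show ?thesis
      unfolding NQ Z_def using \<kappa> w C0
      by (simp add: powr_mult[of \<kappa>] ennreal_mult ac_simps del: power_Suc)
  qed
  also have "\<dots> = (ennreal (\<kappa> powr Q) * ennreal_powr N Q) * ennreal (\<Sum>i. Z i)"
    using sm Z0 unfolding Z_def[symmetric] Q_def[symmetric]
    by (simp add: suminf_ennreal2)
  also have "\<dots> = ennreal_powr (ennreal (\<kappa> * (\<Sum>i. Z i) powr (1 / Q)) * N) Q"
  proof -
    have "0 \<le> (\<Sum>i. Z i)" using sm Z0 by (intro suminf_nonneg) (auto simp: Z_def Q_def)
    then show ?thesis
      using \<kappa> P PQ by (simp add: ennreal_powr_mult powr_mult powr_powr ennreal_mult ac_simps)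
  qed
  finally show ?thesis
    unfolding lp_norm_le_iff[OF q q0] L_def Z_def Q_def N_def .
qed

text \<open>A supremum involves no counting of overlaps: at each point one ball of the cover is
  enough, and the local bounds add up by summability of \<open>w\<close>. Countability of
  \<open>S\<close> puts the exceptional sets for all centres and pieces into one null set.\<close>

lemma lp_norm_patch_infinite:
  fixes S :: "'a set" and g h :: "'a \<Rightarrow> 'k::{real_normed_field, second_countable_topology}"
    and G :: "'a \<Rightarrow> nat \<Rightarrow> 'a \<Rightarrow> 'k"
  assumes pos: "\<And>x r. 0 < r \<Longrightarrow> 0 < measure M (ball x r)" and r: "0 < r"
    and S: "pairwise (\<lambda>x y. r \<le> dist x y) S" and cover: "\<And>x. \<exists>s\<in>S. x \<in> ball s r"
    and q: "q = \<infinity>"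
    and [measurable]: "g \<in> borel_measurable M" "h \<in> borel_measurable M"
    and F [measurable]: "F \<in> sets M"
    and g: "\<And>s. s \<in> S \<Longrightarrow> AE y in M. norm (g y) \<le> (\<Sum>k\<le>J s. norm (G s k y))"
    and G: "\<And>s i. s \<in> S \<Longrightarrow> lp_norm M q (ball s r \<inter> F) (G s i)
        \<le> ennreal (\<kappa> * w i) * lp_norm M p (ball s (2 ^ (i + 2) * r)) h"
    and \<kappa>: "0 \<le> \<kappa>" and w: "\<And>i. 0 \<le> w i" and sm: "summable w"
  shows "lp_norm M q F g \<le> ennreal (\<kappa> * (\<Sum>i. w i)) * lp_norm M p UNIV h"
proof (rule lp_norm_infinity_le[OF q])
  define N where "N = lp_norm M p UNIV h"
  have cS: "countable S" by (rule separated_countable[OF pos r S])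
  have N: "lp_norm M p (ball s (2 ^ (i + 2) * r)) h \<le> N" for s i
    unfolding N_def by (intro lp_norm_mono) auto
  have "AE y in M. \<forall>s\<in>S. norm (g y) \<le> (\<Sum>k\<le>J s. norm (G s k y))"
    using cS g by (simp add: AE_ball_countable)
  moreover have "AE y in M. \<forall>s\<in>S. \<forall>i. y \<in> ball s r \<inter> F \<longrightarrow>
      ennreal (norm (G s i y)) \<le> lp_norm M q (ball s r \<inter> F) (G s i)"
    unfolding AE_ball_countable[OF cS] AE_all_countable using lp_norm_AE_le[OF q] by blast
  ultimately show "AE y in M. y \<in> F \<longrightarrow> ennreal (norm (g y)) \<le> ennreal (\<kappa> * (\<Sum>i. w i)) * lp_norm M p UNIV h"
  proof (eventually_elim, intro impI)
    fix y assume g': "\<forall>s\<in>S. norm (g y) \<le> (\<Sum>k\<le>J s. norm (G s k y))"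
      and G': "\<forall>s\<in>S. \<forall>i. y \<in> ball s r \<inter> F \<longrightarrow>
        ennreal (norm (G s i y)) \<le> lp_norm M q (ball s r \<inter> F) (G s i)"
      and y: "y \<in> F"
    obtain s where s: "s \<in> S" "y \<in> ball s r" using cover[of y] by blast
    have "ennreal (norm (g y)) \<le> (\<Sum>k\<le>J s. ennreal (norm (G s k y)))"
      using g' s by (subst sum_ennreal) (auto intro: ennreal_leI)
    also have "\<dots> \<le> (\<Sum>k\<le>J s. ennreal (\<kappa> * w k) * N)"
    proof (intro sum_mono)
      fix k
      have "ennreal (norm (G s k y)) \<le> lp_norm M q (ball s r \<inter> F) (G s k)"
        using G' s y by blast
      also have "\<dots> \<le> ennreal (\<kappa> * w k) * lp_norm M p (ball s (2 ^ (k + 2) * r)) h"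
        by (rule G[OF s(1)])
      also have "\<dots> \<le> ennreal (\<kappa> * w k) * N"
        by (intro mult_left_mono N) auto
      finally show "ennreal (norm (G s k y)) \<le> ennreal (\<kappa> * w k) * N" .
    qed
    also have "\<dots> = ennreal (\<kappa> * (\<Sum>k\<le>J s. w k)) * N"
      using \<kappa> w by (simp add: sum_distrib_right[symmetric] sum_ennreal sum_distrib_left)
    also have "\<dots> \<le> ennreal (\<kappa> * (\<Sum>i. w i)) * N"
      using \<kappa> w sm by (intro mult_right_mono ennreal_leI mult_left_mono sum_le_suminf) auto
    finally show "ennreal (norm (g y)) \<le> ennreal (\<kappa> * (\<Sum>i. w i)) * lp_norm M p UNIV h"
      unfolding N_def .
  qed
qed (use F in simp_all)

end

section \<open>Dyadic decomposition around one ball\<close>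

text \<open>The pieces \<open>4B, C\<^sub>2(B), C\<^sub>3(B), \<dots>\<close> partition the space; the shift by one makes the index
  start at \<open>0\<close>.\<close>

definition dyadic_piece :: "nat \<Rightarrow> 'a::metric_space \<Rightarrow> real \<Rightarrow> 'a set" where
  "dyadic_piece i x r = (if i = 0 then ball x (4 * r) else dyadic_annulus (i + 1) x r)"

lemma dyadic_piece_sets [measurable]: "dyadic_piece i x r \<in> sets borel"
  by (simp add: dyadic_piece_def)

lemma dyadic_piece_subset: "dyadic_piece i x r \<subseteq> ball x (2 ^ (i + 2) * r)"
  by (auto simp: dyadic_piece_def dyadic_annulus_def)

context doubling_space
begin

text \<open>Each larger ball is the disjoint union of the previous one and the next piece, so finite
  subadditivity applies inductively. The truncation to a ball keeps the sum finite.\<close>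

lemma sublinear_dyadic_pieces:
  fixes D :: "('a \<Rightarrow> 'k::{real_normed_field, second_countable_topology}) set"
  assumes D: "operator_domain M D" and U: "sublinear_operator M D U" and h: "h \<in> D" and r: "0 < r"
  shows "AE y in M. norm (U (restr (ball x (2 ^ (i + 2) * r)) h) y)
    \<le> (\<Sum>k\<le>i. norm (U (restr (dyadic_piece k x r) h) y))"
proof (induction i)
  case 0
  then show ?case by (simp add: dyadic_piece_def)
next
  case (Suc i)
  let ?B = "ball x (2 ^ (i + 2) * r)"
  have D': "restr A h \<in> D" if "A \<in> sets M" for A
    using D h that unfolding operator_domain_def by auto
  have "?B \<subseteq> ball x (2 ^ (Suc i + 2) * r)"
    using r by (intro subset_ball mult_right_mono power_increasing) auto
  then have eq: "restr (ball x (2 ^ (Suc i + 2) * r)) h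
      = (\<lambda>y. restr ?B h y + restr (dyadic_piece (Suc i) x r) h y)"
    by (auto simp: restr_def dyadic_piece_def dyadic_annulus_def indicator_def fun_eq_iff)
  have "AE y in M. norm (U (restr (ball x (2 ^ (Suc i + 2) * r)) h) y)
    \<le> norm (U (restr ?B h) y) + norm (U (restr (dyadic_piece (Suc i) x r) h) y)"
    using U D'[of ?B] D'[of "dyadic_piece (Suc i) x r"]
    unfolding sublinear_operator_def eq by auto
  with Suc show ?case
    by eventually_elim simp
qed

text \<open>The estimates on balls at the scale \<open>r = sqrt t\<close>. Piece \<open>0\<close> is
  itself a ball and uses the first estimate with radius \<open>4 * r\<close>; piece
  \<open>i > 0\<close> uses the annulus estimate with \<open>j = i + 1\<close>. Lower growth turns
  the remaining volume power into a power of \<open>t\<close>.\<close>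

lemma lp_norm_dyadic_piece_le:
  fixes D :: "('a \<Rightarrow> 'k::{real_normed_field, second_countable_topology}) set"
  assumes pq: "1 \<le> p" "p < q" and n: "0 < n" and c: "0 < c" and C: "0 < C" and cl: "0 < cl"
    and \<theta>: "0 < \<theta>1" "0 < \<theta>2" and t: "0 < t"
    and lower: "\<And>x r. 0 < r \<Longrightarrow> cl * r powr n \<le> measure M (ball x r)"
    and est1: "\<And>r. 0 < r \<Longrightarrow> lp_mean M q (ball x r) (ball x r) (U (restr (ball x r) h))
          \<le> ennreal (C * Upsilon (r / sqrt t) powr \<theta>2) * lp_mean M p (ball x r) (ball x r) h"
    and est2: "\<And>r j. 0 < r \<Longrightarrow> 2 \<le> j \<Longrightarrow>
          lp_mean M q (ball x r) (ball x r) (U (restr (dyadic_annulus j x r) h))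
            \<le> ennreal (C * 2 powr (real j * \<theta>1) * Upsilon (2 ^ j * r / sqrt t) powr \<theta>2
                        * exp (- (c * 4 ^ j * r\<^sup>2 / t)))
               * lp_mean M p (ball x (2 ^ (j + 1) * r)) (dyadic_annulus j x r) h"
    and [measurable]: "h \<in> borel_measurable M" "\<And>i. U (restr (dyadic_piece i x (sqrt t)) h) \<in> borel_measurable M"
  shows "lp_norm M q (ball x (sqrt t)) (U (restr (dyadic_piece i x (sqrt t)) h))
    \<le> ennreal (C * 4 powr \<theta>2 * exp (4 * c) * cl powr - (enn2real (1 / p) - enn2real (1 / q))
          * t powr - ((n * enn2real (1 / p) - n * enn2real (1 / q)) / 2)
          * ((2 powr (\<theta>1 + \<theta>2)) ^ (i + 1) * exp (- (c * 4 ^ (i + 1)))))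
       * lp_norm M p (ball x (2 ^ (i + 2) * sqrt t)) h"
proof -
  define a b where "a = enn2real (1 / p)" and "b = enn2real (1 / q)"
  have ab: "0 \<le> b" "b < a" using enn2real_inverse_less[OF pq] by (auto simp: a_def b_def)
  define r where "r = sqrt t"
  have r: "0 < r" "r\<^sup>2 = t" using t by (auto simp: r_def)
  let ?G = "U (restr (dyadic_piece i x r) h)"
  define B where "B = ball x (2 ^ (i + 2) * r)"
  \<comment> \<open>The ball normalising the left side: for piece \<open>0\<close> it is the source
    ball itself, since there the estimate is taken from a ball to the same ball.\<close>
  define W where "W = (if i = 0 then ball x (4 * r) else ball x r)"
  \<comment> \<open>The factor \<open>4 powr \<theta>2\<close> comes from \<open>Upsilon 4\<close>.
    The factor \<open>exp (4 * c)\<close> cancels the artificial Gaussian weight at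
    \<open>i = 0\<close>, so that all pieces share one formula.\<close>
  define K where "K = C * 4 powr \<theta>2 * exp (4 * c) * ((2 powr (\<theta>1 + \<theta>2)) ^ (i + 1) * exp (- (c * 4 ^ (i + 1))))"
  have K: "0 < K" using C by (simp add: K_def)
  have i2: "1 * r \<le> 2 ^ (i + 2) * r"
    using r by (intro mult_right_mono one_le_power) auto
  have "ball x r \<subseteq> B"
    unfolding B_def using i2 by (intro subset_ball) simp
  have "cl * r powr n \<le> measure M (ball x r)" by (rule lower[OF r(1)])
  also have "\<dots> \<le> measure M B"
    using \<open>ball x r \<subseteq> B\<close> unfolding B_def by (intro measure_mono_ball) auto
  finally have lowB: "cl * r powr n \<le> measure M B" .
  have WB: "W \<subseteq> B" "ball x r \<subseteq> W"
    using \<open>ball x r \<subseteq> B\<close> r by (auto simp: W_def B_def)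
  have mW: "measure M W \<le> measure M B"
    using WB unfolding B_def by (intro measure_mono_ball) (auto simp: W_def)
  have cr: "0 < cl * r powr n" using cl r by simp
  have posW: "0 < measure M W"
    using lower[of r x] lower[of "4 * r" x] cl r
    by (auto simp: W_def intro: less_le_trans[rotated])
  have posB: "0 < measure M B" using cr lowB by linarith
  have VB: "0 < emeasure M B" "emeasure M B < \<infinity>"
    using posB by (auto simp: B_def emeasure_ball ennreal_less_zero_iff)
  have VW: "0 < emeasure M W" "emeasure M W < \<infinity>"
    using posW by (auto simp: W_def emeasure_ball ennreal_less_zero_iff)
  have mean: "lp_mean M q W W ?G \<le> ennreal K * lp_mean M p B (dyadic_piece i x r) h"
  proof (cases "i = 0")
    case True
    have "1 \<le> 2 powr (\<theta>1 + \<theta>2)"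
      using \<theta> by (intro ge_one_powr_ge_zero) auto
    then have "C * 4 powr \<theta>2 * 1 \<le> C * 4 powr \<theta>2 * (2 powr (\<theta>1 + \<theta>2))"
      using C by (intro mult_left_mono) auto
    also have "\<dots> = K" using True by (simp add: K_def mult.commute[of c] exp_minus)
    finally have "C * Upsilon ((4 * r) / sqrt t) powr \<theta>2 \<le> K"
      using r t by (simp add: r_def[symmetric] Upsilon_def)
    moreover have "lp_mean M q W W ?G
      \<le> ennreal (C * Upsilon ((4 * r) / sqrt t) powr \<theta>2) * lp_mean M p B (dyadic_piece i x r) h"
      using est1[of "4 * r"] r True by (simp add: W_def B_def dyadic_piece_def)
    ultimately show ?thesis
      by (elim order_trans) (intro mult_right_mono ennreal_leI, auto)
  next
    case False
    let ?j = "i + 1"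
    have "1 * 1 \<le> 4 powr \<theta>2 * exp (4 * c)"
      using \<theta> c by (intro mult_mono ge_one_powr_ge_zero) auto
    then have "C * ((2 powr (\<theta>1 + \<theta>2)) ^ ?j * exp (- (c * 4 ^ ?j))) * 1 
       \<le> C * ((2 powr (\<theta>1 + \<theta>2)) ^ ?j * exp (- (c * 4 ^ ?j))) * (4 powr \<theta>2 * exp (4 * c))"
      using C by (intro mult_left_mono) auto
    also have "\<dots> = K" by (simp add: K_def ac_simps)
    finally have le: "C * ((2 powr (\<theta>1 + \<theta>2)) ^ ?j * exp (- (c * 4 ^ ?j))) \<le> K" by simp
    have "2 powr (real ?j * \<theta>1) * Upsilon (2 ^ ?j * r / sqrt t) powr \<theta>2
        = (2 powr (\<theta>1 + \<theta>2)) ^ ?j"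
    proof -
      have "2 ^ ?j * r / sqrt t = 2 ^ ?j" using r by (simp add: r_def)
      moreover have "Upsilon (2 ^ ?j) = 2 powr real ?j"
      proof -
        have "(1::real) \<le> 2 ^ ?j" by (rule one_le_power) simp
        then have "inverse (2 ^ ?j) \<le> (2 ^ ?j :: real)"
          by (intro order_trans[OF le_imp_inverse_le[of 1 "2 ^ ?j"]]) auto
        moreover have "2 powr real ?j = 2 ^ ?j" by (rule powr_realpow) simp
        ultimately show ?thesis by (simp only: Upsilon_def max_absorb1)
      qed
      moreover have "(2 powr (\<theta>1 + \<theta>2)) ^ ?j = 2 powr (real ?j * \<theta>1) * (2 powr real ?j) powr \<theta>2"
        by (simp add: powr_powr powr_add[symmetric] powr_realpow[symmetric] algebra_simps del: power_Suc of_nat_Suc)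
      ultimately show ?thesis by simp
    qed
    moreover have "c * 4 ^ ?j * r\<^sup>2 / t = c * 4 ^ ?j" using r t by simp
    ultimately have "C * 2 powr (real ?j * \<theta>1) * Upsilon (2 ^ ?j * r / sqrt t) powr \<theta>2
        * exp (- (c * 4 ^ ?j * r\<^sup>2 / t)) \<le> K"
      using le by (simp only: mult.assoc[symmetric]) (simp only: mult.assoc)
    moreover have "lp_mean M q W W ?G
        \<le> ennreal (C * 2 powr (real ?j * \<theta>1) * Upsilon (2 ^ ?j * r / sqrt t) powr \<theta>2
                        * exp (- (c * 4 ^ ?j * r\<^sup>2 / t))) * lp_mean M p B (dyadic_piece i x r) h"
      using est2[of r ?j] r False by (simp add: W_def B_def dyadic_piece_def)
    ultimately show ?thesis
      by (elim order_trans) (intro mult_right_mono ennreal_leI, auto)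
  qed
  let ?N = "lp_norm M p B h"
  have "lp_norm M q (ball x r) ?G \<le> lp_norm M q W ?G"
    unfolding r_def using WB by (intro lp_norm_mono AE_I2) (auto simp: r_def simp del: mem_ball)
  also have "\<dots> = lp_mean M q W W ?G * ennreal (measure M W powr b)"
    unfolding lp_mean_eq[OF VW] b_def[symmetric] using posW
    by (simp add: mult.assoc ennreal_mult[symmetric] powr_add[symmetric])
  also have "\<dots> \<le> (ennreal K * lp_mean M p B (dyadic_piece i x r) h) * ennreal (measure M W powr b)"
    by (intro mult_right_mono mean) auto
  also have "\<dots> = (ennreal K * (lp_norm M p (dyadic_piece i x r) h * ennreal (measure M B powr - a))) * ennreal (measure M W powr b)"
    unfolding lp_mean_eq[OF VB] a_def ..
  also have "\<dots> \<le> (ennreal K * (?N * ennreal (measure M B powr - a))) * ennreal (measure M W powr b)"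
    unfolding B_def using dyadic_piece_subset[of i x r]
    by (intro mult_right_mono mult_left_mono lp_norm_mono AE_I2) auto
  also have "\<dots> = ennreal (K * (measure M B powr - a * measure M W powr b)) * ?N"
    using K by (simp add: ennreal_mult ac_simps)
  also have "\<dots> \<le> ennreal (K * (cl powr - (a - b) * t powr - ((n * a - n * b) / 2))) * ?N"
  proof (intro mult_right_mono ennreal_leI mult_left_mono)
    \<comment> \<open>Since \<open>W\<close> lies in \<open>B\<close>, the volumes combine to a
      negative power of that of \<open>B\<close>. The lower growth bound therefore gives an upper
      bound, and \<open>r = sqrt t\<close> turns it into a power of \<open>t\<close>.\<close>
    have "measure M B powr - a * measure M W powr b \<le> measure M B powr - a * measure M B powr b"
      using mW ab by (intro mult_left_mono powr_mono2) auto
    also have "\<dots> = measure M B powr - (a - b)"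
      using posB by (simp add: powr_add[symmetric])
    also have "\<dots> \<le> (cl * r powr n) powr - (a - b)"
      using ab lowB cr by (intro powr_mono2') auto
    also have "\<dots> = cl powr - (a - b) * t powr - ((n * a - n * b) / 2)"
      using cl t by (simp add: powr_mult powr_powr r_def powr_half_sqrt[symmetric] algebra_simps diff_divide_distrib)
    finally show "measure M B powr - a * measure M W powr b \<le> \<dots>" .
  qed (use K in auto)
  finally show ?thesis
    unfolding K_def a_def b_def r_def B_def by (simp only: ac_simps)
qed

text \<open>If the small ball misses \<open>F\<close> or the large one misses \<open>E\<close>, both
  sides are trivial. Otherwise \<open>setdist E F\<close> is at most
  \<open>2 * 2 ^ (i + 2) * r\<close>, hence its square is at most
  \<open>16 * 4 ^ (i + 1) * r\<^sup>2\<close>. Half of the exponent then pays for the off-diagonal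
  factor with constant \<open>c / 32\<close>.\<close>

lemma gaussian_localization:
  fixes h :: "'a \<Rightarrow> 'k::{real_normed_field, second_countable_topology}"
  assumes est: "lp_norm M q (ball x r) g \<le> ennreal (K * exp (- (c * 4 ^ (i + 1)))) * lp_norm M p (ball x (2 ^ (i + 2) * r)) h"
    and [measurable]: "g \<in> borel_measurable M" "h \<in> borel_measurable M"
    and F [measurable]: "F \<in> sets M"
    and h: "\<And>y. y \<notin> E \<Longrightarrow> h y = 0" and r: "0 < r" and K: "0 \<le> K" and c: "0 < c"
    and p: "0 < p" and q: "0 < q"
  shows "lp_norm M q (ball x r \<inter> F) g
    \<le> ennreal (K * exp (- (c / 32 * (setdist E F)\<^sup>2 / r\<^sup>2)) * exp (- (c / 2 * 4 ^ (i + 1))))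
      * lp_norm M p (ball x (2 ^ (i + 2) * r)) h"
proof -
  let ?R = "2 ^ (i + 2) * r"
  have BF: "ball x r \<inter> F \<in> sets M" using F by auto
  have mono: "lp_norm M q (ball x r \<inter> F) g \<le> lp_norm M q (ball x r) g"
    using BF by (intro lp_norm_mono) auto
  consider "ball x r \<inter> F = {}" | "ball x ?R \<inter> E = {}"
    | u v where "u \<in> ball x r" "u \<in> F" "v \<in> ball x ?R" "v \<in> E"
    by blast
  then show ?thesis
  proof cases
    case 1
    then have "lp_norm M q (ball x r \<inter> F) g = 0"
      using BF by (intro lp_norm_eq_0) (auto simp: q)
    then show ?thesis by simp
  next
    case 2
    then have "h y = 0" if "y \<in> ball x ?R" for y
      using h that by blast
    then have "lp_norm M p (ball x ?R) h = 0"
      using p by (intro lp_norm_eq_0 AE_I2) auto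
    with est mono show ?thesis by simp
  next
    case 3
    have "setdist E F \<le> dist v u" using 3 by (intro setdist_le_dist)
    also have "\<dots> \<le> dist x v + dist x u" using dist_triangle[of v u x] by (simp add: dist_commute)
    also have "\<dots> \<le> ?R + r" using 3 by simp
    also have "\<dots> \<le> 2 * ?R"
      using mult_right_mono[OF one_le_power[of "2::real" "i + 2"], of r] r by simp
    finally have "(setdist E F)\<^sup>2 \<le> (2 * ?R)\<^sup>2" by (intro power_mono) auto
    also have "(2 * ?R)\<^sup>2 = 16 * 4 ^ (i + 1) * r\<^sup>2"
      by (simp add: power_mult_distrib power_add power2_eq_square power_mult_distrib[symmetric])
    finally have "(setdist E F)\<^sup>2 / r\<^sup>2 \<le> 16 * 4 ^ (i + 1)"
      using r by (simp add: field_simps)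
    then have "c / 32 * ((setdist E F)\<^sup>2 / r\<^sup>2) \<le> c / 32 * (16 * 4 ^ (i + 1))"
      using c by (intro mult_left_mono) auto
    then have "exp (- (c * 4 ^ (i + 1)))
      \<le> exp (- (c / 32 * (setdist E F)\<^sup>2 / r\<^sup>2) + - (c / 2 * 4 ^ (i + 1)))"
      unfolding exp_le_cancel_iff by (simp add: field_simps)
    then have "K * exp (- (c * 4 ^ (i + 1)))
      \<le> K * exp (- (c / 32 * (setdist E F)\<^sup>2 / r\<^sup>2)) * exp (- (c / 2 * 4 ^ (i + 1)))"
      unfolding exp_add mult.assoc using K by (rule mult_left_mono)
    with mono est show ?thesis
      by (elim order_trans) (intro mult_right_mono ennreal_leI, auto)
  qed
qed

text \<open>The constant of the two patching bounds under one name. It depends on \<open>q\<close>,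
  the weights and \<open>C0\<close> only, so it is uniform in the sets, the functions and the
  time.\<close>

definition patch_constant :: "ennreal \<Rightarrow> (nat \<Rightarrow> real) \<Rightarrow> real" where
  "patch_constant q w = (if q = \<infinity> then \<Sum>i. w i
     else (\<Sum>i. (2 ^ (i + 1) * w i) powr enn2real q * C0 ^ (i + 5)) powr (1 / enn2real q))"

lemma summable_gaussian_weights:
  fixes A \<gamma> :: real
  assumes "0 \<le> A" "0 < \<gamma>"
  shows "summable (\<lambda>i. A ^ (i + 1) * exp (- (\<gamma> * 4 ^ (i + 1))))"
  using summable_exp_neg_4_power[OF assms]
    summable_Suc_iff[of "\<lambda>i. A ^ i * exp (- (\<gamma> * 4 ^ i))"] by simp

lemma lp_norm_patch:
  fixes S :: "'a set" and g h :: "'a \<Rightarrow> 'k::{real_normed_field, second_countable_topology}"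
    and G :: "'a \<Rightarrow> nat \<Rightarrow> 'a \<Rightarrow> 'k" and \<beta> \<gamma> :: real
  defines "w \<equiv> \<lambda>i. \<beta> ^ (i + 1) * exp (- (\<gamma> * 4 ^ (i + 1)))"
  assumes pos: "\<And>x r. 0 < r \<Longrightarrow> 0 < measure M (ball x r)" and r: "0 < r"
    and S: "pairwise (\<lambda>x y. r \<le> dist x y) S" and cover: "\<And>x. \<exists>s\<in>S. x \<in> ball s r"
    and p: "0 < p" and pq: "p < q" and \<beta>: "0 \<le> \<beta>" and \<gamma>: "0 < \<gamma>" and \<kappa>: "0 \<le> \<kappa>"
    and meas: "g \<in> borel_measurable M" "h \<in> borel_measurable M" "\<And>s i. G s i \<in> borel_measurable M"
      "F \<in> sets M"
    and g: "\<And>s. s \<in> S \<Longrightarrow> AE y in M. norm (g y) \<le> (\<Sum>k\<le>J s. norm (G s k y))"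
    and G: "\<And>s i. s \<in> S \<Longrightarrow> lp_norm M q (ball s r \<inter> F) (G s i)
        \<le> ennreal (\<kappa> * w i) * lp_norm M p (ball s (2 ^ (i + 2) * r)) h"
  shows "lp_norm M q F g \<le> ennreal (\<kappa> * patch_constant q w) * lp_norm M p UNIV h"
proof (cases "q = \<infinity>")
  case True
  have w: "0 \<le> w i" for i using \<beta> by (simp add: w_def)
  have sm: "summable w"
    unfolding w_def by (rule summable_gaussian_weights[OF \<beta> \<gamma>])
  have "patch_constant q w = (\<Sum>i. w i)"
    using True by (simp add: patch_constant_def)
  with lp_norm_patch_infinite[OF pos r S cover True meas(1,2,4) g G \<kappa> w sm] show ?thesis
    by simp
next
  case False
  define Q where "Q = enn2real q"
  have Q: "0 < Q"
    using p pq False by (auto simp: Q_def enn2real_positive_iff less_top)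
  \<comment> \<open>Taking \<open>Q\<close>-th powers keeps the weights of geometric times Gaussian
    form: \<open>A\<close> collects all geometric factors, the rate becomes
    \<open>\<gamma> * Q\<close>, and a constant \<open>C0 ^ 4\<close> is left over.\<close>
  define A where "A = (2 * \<beta>) powr Q * C0"
  have w: "0 \<le> w i" for i using \<beta> by (simp add: w_def)
  have pow: "(x ^ k) powr Q = (x powr Q) ^ k" if "0 \<le> x" for x :: real and k
    using that by (induction k) (auto simp: powr_mult)
  have "(2 ^ (i + 1) * w i) powr Q * C0 ^ (i + 5)
      = C0 ^ 4 * (A ^ (i + 1) * exp (- (\<gamma> * Q * 4 ^ (i + 1))))" for i
  proof -
    have "(2 ^ (i + 1) * w i) powr Q = ((2 * \<beta>) ^ (i + 1)) powr Q * exp (- (\<gamma> * 4 ^ (i + 1))) powr Q"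
      using \<beta> by (simp add: w_def powr_mult power_mult_distrib mult.assoc del: power_Suc)
    also have "((2 * \<beta>) ^ (i + 1)) powr Q = ((2 * \<beta>) powr Q) ^ (i + 1)"
      using \<beta> by (intro pow) simp
    also have "exp (- (\<gamma> * 4 ^ (i + 1))) powr Q = exp (- (\<gamma> * Q * 4 ^ (i + 1)))"
      by (simp add: powr_def algebra_simps)
    finally show ?thesis
      by (simp add: A_def power_mult_distrib power_add numeral_eq_Suc ac_simps)
  qed
  moreover have "summable (\<lambda>i. C0 ^ 4 * (A ^ (i + 1) * exp (- (\<gamma> * Q * 4 ^ (i + 1)))))"
    using \<gamma> Q C0 by (intro summable_mult summable_gaussian_weights) (auto simp: A_def)
  ultimately have sm: "summable (\<lambda>i. (2 ^ (i + 1) * w i) powr Q * C0 ^ (i + 5))"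
    by simp
  have "patch_constant q w = (\<Sum>i. (2 ^ (i + 1) * w i) powr Q * C0 ^ (i + 5)) powr (1 / Q)"
    using False by (simp add: patch_constant_def Q_def)
  with lp_norm_patch_finite[OF pos r S cover p pq False meas g G \<kappa> w sm[unfolded Q_def]] show ?thesis
    by (simp only: Q_def)
qed

lemma patch_constant_nonneg:
  assumes "0 \<le> \<beta>" "0 < \<gamma>"
  shows "0 \<le> patch_constant q (\<lambda>i. \<beta> ^ (i + 1) * exp (- (\<gamma> * 4 ^ (i + 1))))"
  using suminf_nonneg[OF summable_gaussian_weights[OF assms]] assms
  by (simp add: patch_constant_def)

lemma off_diagonal_on_balls_imp_full:
  fixes D :: "('a \<Rightarrow> 'k::{real_normed_field, second_countable_topology}) set"
  assumes D: "operator_domain M D" and S: "\<And>t. 0 < t \<Longrightarrow> sublinear_operator M D (T t)"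
    and pq: "1 \<le> p" "p < q" and n: "0 < n" and growth: "lower_growth M n"
    and trunc: "\<And>t. 0 < t \<Longrightarrow> determined_by_truncations M p D (T t)"
    and balls: "off_diagonal_on_balls M D T p q"
  shows "full_off_diagonal M D T p q ((n * enn2real (1 / p) - n * enn2real (1 / q)) / 2)"
proof -
  define a b where "a = enn2real (1 / p)" and "b = enn2real (1 / q)"
  have ab: "0 \<le> b" "b < a"
    using enn2real_inverse_less[OF pq] by (auto simp: a_def b_def)
  define \<theta> where "\<theta> = (n * a - n * b) / 2"
  have \<theta>: "0 < \<theta>" using n ab by (simp add: \<theta>_def)
  have p: "0 < p" and q: "0 < q"
    using pq by (auto intro: less_le_trans[OF zero_less_one] less_trans)
  obtain \<theta>1 \<theta>2 c C where \<theta>12: "0 < \<theta>1" "0 < \<theta>2" and c: "0 < c" and C: "0 < C"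
    and est: "\<forall>t>0. \<forall>x. \<forall>r>0. \<forall>f\<in>D.
        lp_mean M q (ball x r) (ball x r) (T t (restr (ball x r) f))
          \<le> ennreal (C * Upsilon (r / sqrt t) powr \<theta>2) * lp_mean M p (ball x r) (ball x r) f \<and>
        (\<forall>j\<ge>2.
          lp_mean M q (ball x r) (ball x r) (T t (restr (dyadic_annulus j x r) f))
            \<le> ennreal (C * 2 powr (real j * \<theta>1) * Upsilon (2 ^ j * r / sqrt t) powr \<theta>2
                        * exp (- (c * 4 ^ j * r\<^sup>2 / t)))
               * lp_mean M p (ball x (2 ^ (j + 1) * r)) (dyadic_annulus j x r) f \<and>
          lp_mean M q (ball x (2 ^ (j + 1) * r)) (dyadic_annulus j x r) (T t (restr (ball x r) f))
            \<le> ennreal (C * 2 powr (real j * \<theta>1) * Upsilon (2 ^ j * r / sqrt t) powr \<theta>2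
                        * exp (- (c * 4 ^ j * r\<^sup>2 / t)))
               * lp_mean M p (ball x r) (ball x r) f)"
    using balls unfolding off_diagonal_on_balls_def by (elim conjE exE) (rule that)
  obtain cl where cl: "0 < cl"
    and lower: "\<And>x r. 0 < r \<Longrightarrow> cl * r powr n \<le> measure M (ball x r)"
    using growth unfolding lower_growth_def emeasure_ball by (auto simp: ennreal_le_iff)
  have pos: "0 < measure M (ball x r)" if "0 < r" for x r
    using lower[OF that, of x] cl that by (intro less_le_trans[OF _ lower]) auto
  define \<beta> where "\<beta> = 2 powr (\<theta>1 + \<theta>2)"
  have \<beta>: "0 \<le> \<beta>" by (simp add: \<beta>_def)
  have c2: "0 < c / 2" using c by simp
  \<comment> \<open>The added \<open>1\<close> makes the constant strictly positive, as full
    estimates require.\<close>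
  define Z where "Z = patch_constant q (\<lambda>i. \<beta> ^ (i + 1) * exp (- (c / 2 * 4 ^ (i + 1)))) + 1"
  have Z: "0 < Z"
    unfolding Z_def using patch_constant_nonneg[OF \<beta> c2, of q] by simp
  define K where "K = C * 4 powr \<theta>2 * exp (4 * c) * cl powr - (a - b)"
  have K: "0 < K" using C cl by (simp add: K_def)
  have meas: "f \<in> borel_measurable M" if "f \<in> D" for f
    using that D by (auto simp: operator_domain_def)
  have restrD: "restr A f \<in> D" if "f \<in> D" "A \<in> sets M" for f A
    using that D by (auto simp: operator_domain_def)
  have Tmeas: "T t f \<in> borel_measurable M" if "f \<in> D" "0 < t" for f t
    using that S by (auto simp: sublinear_operator_def)
  \<comment> \<open>The case of bounded support, with constants independent of \<open>x0\<close> and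
    \<open>R\<close>. This uniformity is what survives the passage to the limit over
    truncations.\<close>
  have bounded: "lp_norm M q F (T t h)
      \<le> ennreal (K * t powr - \<theta> * exp (- (c / 32 * (setdist E F)\<^sup>2 / t)) * Z) * lp_norm M p UNIV h"
    if F: "closed F" and h: "h \<in> D" and t: "0 < t" and hE: "\<And>y. y \<notin> E \<Longrightarrow> h y = 0"
      and hR: "\<And>y. y \<notin> ball x0 R \<Longrightarrow> h y = 0" for E F h t x0 R
  proof -
    define r where "r = sqrt t"
    have r: "0 < r" and rt: "r\<^sup>2 = t" using t by (auto simp: r_def)
    obtain S0 :: "'a set" where S0: "pairwise (\<lambda>x y. r \<le> dist x y) S0" "\<And>x. \<exists>s\<in>S0. x \<in> ball s r"
      by (rule maximal_separated_set[OF r]) (rule that)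
    \<comment> \<open>The number of pieces that exhaust the support varies with the centre
      \<open>s\<close>. This is harmless because the patching bounds do not depend on
      \<open>J\<close>.\<close>
    have "\<exists>J. restr (ball s (2 ^ (J + 2) * r)) h = h" for s
    proof -
      obtain J where "(dist s x0 + R) / r < 2 ^ J"
        using real_arch_pow[of 2 "(dist s x0 + R) / r"] by auto
      then have "dist s x0 + R < 2 ^ J * r" using r by (simp add: field_simps)
      also have "\<dots> \<le> 2 ^ (J + 2) * r"
        using r by (intro mult_right_mono power_increasing) auto
      finally have J: "dist s x0 + R < 2 ^ (J + 2) * r" .
      have "h y = 0" if "y \<notin> ball s (2 ^ (J + 2) * r)" for y
      proof (rule hR)
        show "y \<notin> ball x0 R"
          using that J dist_triangle[of s y x0] unfolding mem_ball by linarith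
      qed
      then have "restr (ball s (2 ^ (J + 2) * r)) h = h"
        by (auto simp: restr_def indicator_def fun_eq_iff)
      then show ?thesis ..
    qed
    then obtain J where J: "\<And>s. restr (ball s (2 ^ (J s + 2) * r)) h = h"
      by metis
    have Gm: "T t (restr (dyadic_piece i s r) h) \<in> borel_measurable M" for i s
      using h t by (intro Tmeas restrD) auto
    have local: "lp_norm M q (ball s r) (T t (restr (dyadic_piece i s r) h))
      \<le> ennreal (K * t powr - \<theta> * \<beta> ^ (i + 1) * exp (- (c * 4 ^ (i + 1))))
         * lp_norm M p (ball s (2 ^ (i + 2) * r)) h" for s i
    proof -
      note * = lp_norm_dyadic_piece_le[OF pq n c C cl \<theta>12 t lower, where U = "T t" and h = h and x = s and i = i,
          folded a_def b_def \<beta>_def r_def, folded \<theta>_def K_def]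
      have "lp_norm M q (ball s r) (T t (restr (dyadic_piece i s r) h))
        \<le> ennreal (K * t powr - \<theta> * (\<beta> ^ (i + 1) * exp (- (c * 4 ^ (i + 1)))))
           * lp_norm M p (ball s (2 ^ (i + 2) * r)) h"
        by (rule *) (use est[rule_format, OF t _ h] meas[OF h] Gm in \<open>simp_all add: r_def\<close>)
      then show ?thesis by (simp only: mult.assoc)
    qed
    have Fm: "F \<in> sets M" using F by simp
    let ?\<kappa> = "K * t powr - \<theta> * exp (- (c / 32 * (setdist E F)\<^sup>2 / t))"
    have \<kappa>: "0 \<le> ?\<kappa>" using K by simp
    have "lp_norm M q F (T t h)
      \<le> ennreal (?\<kappa> * patch_constant q (\<lambda>i. \<beta> ^ (i + 1) * exp (- (c / 2 * 4 ^ (i + 1)))))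
        * lp_norm M p UNIV h"
    proof (rule lp_norm_patch[OF pos r S0 p pq(2) \<beta> c2 \<kappa> Tmeas[OF h t] meas[OF h] Gm Fm, where J = J])
      show "AE y in M. norm (T t h y) \<le> (\<Sum>k\<le>J s. norm (T t (restr (dyadic_piece k s r) h) y))" for s
        using sublinear_dyadic_pieces[OF D S[OF t] h r, of s "J s"] by (simp only: J)
      show "lp_norm M q (ball s r \<inter> F) (T t (restr (dyadic_piece i s r) h))
        \<le> ennreal (K * t powr - \<theta> * exp (- (c / 32 * (setdist E F)\<^sup>2 / t)) *
            (\<beta> ^ (i + 1) * exp (- (c / 2 * 4 ^ (i + 1))))) * lp_norm M p (ball s (2 ^ (i + 2) * r)) h" for s i
        using gaussian_localization[OF local[of s i] Gm meas[OF h] Fm hE r _ c p q] K \<beta>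
        by (simp add: rt ac_simps)
    qed
    also have "\<dots> \<le> ennreal (?\<kappa> * Z) * lp_norm M p UNIV h"
      using \<kappa> by (intro mult_right_mono ennreal_leI mult_left_mono) (auto simp: Z_def)
    finally show ?thesis .
  qed
  have "lp_norm M q F (T t (restr E f))
      \<le> ennreal (K * Z * t powr - \<theta> * exp (- (c / 32 * (setdist E F)\<^sup>2 / t))) * lp_norm M p E f"
    if E: "closed E" and F: "closed F" and f: "f \<in> D" and t: "0 < t" for E F f t
  proof -
    let ?g = "restr E f"
    let ?\<kappa> = "K * t powr - \<theta> * exp (- (c / 32 * (setdist E F)\<^sup>2 / t)) * Z"
    have \<kappa>: "0 < ?\<kappa>" using K Z t by simp
    have g: "?g \<in> D" using f E by (intro restrD) auto
    have N: "lp_norm M p UNIV ?g = lp_norm M p E f"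
      by (simp add: lp_norm_restr[OF p])
    have "lp_norm M q F (T t ?g) \<le> ennreal ?\<kappa> * lp_norm M p UNIV ?g"
    \<comment> \<open>The truncation hypothesis concerns finite norms only. For infinite norm the
      right side is infinite, because its constant is positive.\<close>
    proof (cases "lp_norm M p UNIV ?g < \<infinity>")
      case True
      with trunc[OF t] g obtain x R where
        lim: "AE y in M. ennreal (norm (T t ?g y)) \<le> liminf (\<lambda>k. ennreal (norm (T t (restr (ball x (R k)) ?g) y)))"
        unfolding determined_by_truncations_def by blast
      have hD: "restr (ball x (R k)) ?g \<in> D" for k :: nat
        by (rule restrD[OF g]) simp
      show ?thesis
      proof (rule lp_norm_liminf_le[OF _ _ _ lim _ q])
        fix k
        have "lp_norm M q F (T t (restr (ball x (R k)) ?g))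
            \<le> ennreal ?\<kappa> * lp_norm M p UNIV (restr (ball x (R k)) ?g)"
          \<comment> \<open>Truncation keeps the function zero off \<open>E\<close> and does not
            increase its norm, so the bound is the same for every \<open>k\<close>.\<close>
          by (rule bounded[OF F hD t, where ?x0.0 = x and R = "R k"]) (auto simp: restr_def)
        also have "\<dots> \<le> ennreal ?\<kappa> * lp_norm M p UNIV ?g"
          using meas[OF hD[of k]] by (intro mult_left_mono lp_norm_mono) (auto simp: restr_def indicator_def)
        finally show "lp_norm M q F (T t (restr (ball x (R k)) ?g)) \<le> ennreal ?\<kappa> * lp_norm M p UNIV ?g" .
      qed (use Tmeas[OF g t] Tmeas[OF hD t] F in simp_all)
    next
      case False
      then have "lp_norm M p UNIV ?g = top" by (simp add: not_less top_unique)
      moreover have "ennreal k * top = top" if "0 < k" for k :: real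
        using that by (simp add: ennreal_mult_top)
      ultimately show ?thesis using \<kappa> by (simp only: top_greatest)
    qed
    then show ?thesis unfolding N by (simp add: ac_simps)
  qed
  then show ?thesis
    unfolding full_off_diagonal_def a_def[symmetric] b_def[symmetric] \<theta>_def[symmetric]
    using \<theta> K Z c
    by (intro conjI exI[of _ "K * Z"] exI[of _ "c / 32"] allI impI ballI) auto
qed

end

theorem proposition3p2:
  fixes M :: "'a::metric_space measure"
    and D :: "('a \<Rightarrow> 'k::{real_normed_field, second_countable_topology}) set"
    and T :: "real \<Rightarrow> ('a \<Rightarrow> 'k) \<Rightarrow> 'a \<Rightarrow> 'k"
    and p q :: ennreal
  assumes "homogeneous_type M"
    and "1 \<le> p" and "p < q"
    and "operator_domain M D"
    and "\<And>t. 0 < t \<Longrightarrow> sublinear_operator M D (T t)"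
  shows "(\<forall>n>0. upper_growth M n \<longrightarrow>
            full_off_diagonal M D T p q ((n * enn2real (1 / p) - n * enn2real (1 / q)) / 2) \<longrightarrow>
            off_diagonal_on_balls M D T p q) \<and>
         (\<forall>n>0. lower_growth M n \<longrightarrow>
            (\<forall>t>0. determined_by_truncations M p D (T t)) \<longrightarrow>
            off_diagonal_on_balls M D T p q \<longrightarrow>
            full_off_diagonal M D T p q ((n * enn2real (1 / p) - n * enn2real (1 / q)) / 2))"
proof -
  obtain C0 where "doubling_space M C0"
    using assms(1) by (rule homogeneous_type_imp_doubling)
  then interpret doubling_space M C0 .
  show ?thesis
  proof (intro conjI allI impI)
    fix n :: real
    assume n: "0 < n" "upper_growth M n"
      and full: "full_off_diagonal M D T p q ((n * enn2real (1 / p) - n * enn2real (1 / q)) / 2)"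
    show "off_diagonal_on_balls M D T p q"
      by (rule full_off_diagonal_imp_on_balls[OF assms(4) _ assms(2,3) n full]) (rule assms(5))
  next
    fix n :: real
    assume n: "0 < n" "lower_growth M n"
      and trunc: "\<forall>t>0. determined_by_truncations M p D (T t)"
      and balls: "off_diagonal_on_balls M D T p q"
    show "full_off_diagonal M D T p q ((n * enn2real (1 / p) - n * enn2real (1 / q)) / 2)"
      by (rule off_diagonal_on_balls_imp_full[OF assms(4) _ assms(2,3) n _ balls]) (simp_all add: trunc assms(5))
  qed
qed

end
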